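(* Let $\alpha>0$. Let $$\Delta(s,\alpha):=\lim_{n\to\infty}\frac{D_n\left(\frac{s}{2n+1+\alpha},\alpha\right)}{D_n(0,\alpha)},\qquad C(s):=\lim_{n\to\infty}\frac{y_n\left(\frac{s}{2n+1+\alpha}\right)}{\frac{s}{2n+1+\alpha}}$$ be the double-scaled Hankel determinant and the associated $C$ potential, where $n\to\infty$ with $s=(2n+1+\alpha)t$ fixed. Then $$\ln\Delta(s,\alpha)=\int_0^s\left\{\frac14\left(\frac{\xi}{C(\xi)}\frac{dC(\xi)}{d\xi}\right)^2-\frac{\xi\,C(\xi)}{2}-\frac14\left(\frac{1}{C(\xi)}-\alpha\right)^2\right\}\frac{d\xi}{\xi}.$$
   Context: For $\alpha>0$, $t\ge 0$, the perturbed Laguerre weight is $w(x;t,\alpha)=x^{\alpha}e^{-x-t/x}$, $x\in\mathbb{R}_+=(0,\infty)$, and the Hankel determinant is $D_n(t,\alpha)=\det\left(\int_0^\infty x^{j+k}w(x;t,\alpha)\,dx\right)_{j,k=0}^{n-1}$. Let $P_n(x)=P_n(x;t,\alpha)$ be the monic polynomials orthogonal with respect to $w(x;t,\alpha)$ on $\mathbb{R}_+$; they satisfy $xP_n(x)=P_{n+1}(x)+\alpha_n(t)P_n(x)+\beta_n(t)P_{n-1}(x)$ with $P_0=1$, $\beta_0P_{-1}=0$. The auxiliary quantity $y_n(t)$ is defined by $\alpha_n(t)=2n+1+\alpha+y_n(t)$. *)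

theory Defs
  imports
    "HOL-Analysis.Analysis"
    "HOL-Computational_Algebra.Polynomial"
    "Jordan_Normal_Form.Determinant"
begin

definition weight :: "real \<Rightarrow> real \<Rightarrow> real \<Rightarrow> real" where
  "weight t \<alpha> x = x powr \<alpha> * exp (- x - t / x)"

definition hankel_det :: "nat \<Rightarrow> real \<Rightarrow> real \<Rightarrow> real" where
  "hankel_det n t \<alpha> = Determinant.det
     (mat n n (\<lambda>(j, k). LINT x:{0<..}|lborel. x ^ (j + k) * weight t \<alpha> x))"

definition monic_orthogonal :: "real \<Rightarrow> real \<Rightarrow> (nat \<Rightarrow> real poly) \<Rightarrow> bool" where
  "monic_orthogonal t \<alpha> P \<longleftrightarrow>
     (\<forall>n. degree (P n) = n \<and> lead_coeff (P n) = 1) \<and>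
     (\<forall>m n. m \<noteq> n \<longrightarrow>
        (LINT x:{0<..}|lborel. poly (P m) x * poly (P n) x * weight t \<alpha> x) = 0)"

definition orth_poly :: "real \<Rightarrow> real \<Rightarrow> nat \<Rightarrow> real poly" where
  "orth_poly t \<alpha> = (THE P. monic_orthogonal t \<alpha> P)"

text \<open>The case distinction implements the convention that \<open>b 0 * P\<^sub>-\<^sub>1 = 0\<close>; thus \<open>b 0\<close> is
  left undetermined, while \<open>a\<close> is unique.\<close>

definition three_term_recurrence ::
  "(nat \<Rightarrow> real poly) \<Rightarrow> (nat \<Rightarrow> real) \<Rightarrow> (nat \<Rightarrow> real) \<Rightarrow> bool" where
  "three_term_recurrence P a b \<longleftrightarrow>
     (\<forall>n. [:0, 1:] * P n =
        P (Suc n) + Polynomial.smult (a n) (P n) + (if n = 0 then 0 else Polynomial.smult (b n) (P (n - 1))))"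

definition rec_alpha :: "real \<Rightarrow> real \<Rightarrow> nat \<Rightarrow> real" where
  "rec_alpha t \<alpha> = (THE a. \<exists>b. three_term_recurrence (orth_poly t \<alpha>) a b)"

definition y_aux :: "nat \<Rightarrow> real \<Rightarrow> real \<Rightarrow> real" where
  "y_aux n t \<alpha> = rec_alpha t \<alpha> n - (2 * real n + 1 + \<alpha>)"

definition scaled_time :: "real \<Rightarrow> nat \<Rightarrow> real \<Rightarrow> real" where
  "scaled_time \<alpha> n s = s / (2 * real n + 1 + \<alpha>)"

definition Delta_seq :: "real \<Rightarrow> real \<Rightarrow> nat \<Rightarrow> real" where
  "Delta_seq s \<alpha> n = hankel_det n (scaled_time \<alpha> n s) \<alpha> / hankel_det n 0 \<alpha>"

definition C_seq :: "real \<Rightarrow> real \<Rightarrow> nat \<Rightarrow> real" where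
  "C_seq \<alpha> s n = y_aux n (scaled_time \<alpha> n s) \<alpha> / scaled_time \<alpha> n s"

definition Delta :: "real \<Rightarrow> real \<Rightarrow> real" where
  "Delta s \<alpha> = lim (Delta_seq s \<alpha>)"

definition C_pot :: "real \<Rightarrow> real \<Rightarrow> real" where
  "C_pot \<alpha> s = lim (C_seq \<alpha> s)"

end

theory Submission
  imports Defs "HOL-Real_Asymp.Real_Asymp"
begin

text \<open>
  Fix \<open>t > 0\<close> and let \<open>C\<^sub>n(t)\<close> be the mean of \<open>1/x\<close> against \<open>P\<^sub>n\<^sup>2 w\<close>. Integrating \<open>(x P\<^sub>n\<^sup>2 w)'\<close>
  gives \<open>\<alpha>\<^sub>n = N + t C\<^sub>n(t)\<close> with \<open>N = 2n + 1 + \<alpha>\<close>, so \<open>y\<^sub>n(t) / t = C\<^sub>n(t)\<close>. Integrating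
  \<open>(P\<^sub>n\<^sup>2 w)'\<close> gives \<open>0 < C\<^sub>n \<le> 1/\<alpha>\<close>, and expanding \<open>\<langle>(x - \<alpha>\<^sub>n)\<^sup>2 P\<^sub>n\<^sup>2 / x\<rangle> > 0\<close> gives a lower
  bound of order \<open>1/N\<close> (\<open>arec_eq\<close>, \<open>cpot_le\<close>, \<open>cpot_ge\<close>).

  A closed system of first order equations in \<open>t\<close> holds for \<open>R = t C\<^sub>n\<close> and the mixed mean
  \<open>r = t \<langle>P\<^sub>n, P\<^sub>n\<^sub>-\<^sub>1 / x\<rangle> / h\<^sub>n\<^sub>-\<^sub>1\<close> (\<open>inv_mean_derivative\<close>). It comes from two identities
  between \<open>R\<^sub>n\<close>, \<open>R\<^sub>n\<^sub>-\<^sub>1\<close>, \<open>r\<^sub>n\<close> and the recurrence coefficient \<open>\<beta>\<^sub>n\<close> (\<open>rvar_quadratic\<close>), obtained by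
  dividing by \<open>x\<close>, integrating by parts and eliminating \<open>\<langle>P\<^sub>n / x\<^sup>2\<rangle>\<close>, together with
  \<open>t d/dt ln h\<^sub>n = - R\<^sub>n\<close> and \<open>t d/dt p\<^sub>n = r\<^sub>n\<close>, where \<open>p\<^sub>n\<close> is the subleading coefficient of \<open>P\<^sub>n\<close>.
  Eliminating \<open>r\<close> and writing \<open>t = e\<^sup>\<tau> / N\<close>, \<open>u\<^sub>n(\<tau>) = ln C\<^sub>n(t)\<close>, one gets the Painleve III
  equation in the form
  \<open>u\<^sub>n'' = e\<^sup>\<tau> C\<^sub>n + (e\<^sup>\<tau> C\<^sub>n / N)\<^sup>2 + \<alpha> / C\<^sub>n - 1 / C\<^sub>n\<^sup>2\<close>
  (\<open>painleve_family_log_pot\<close>).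

  The limit exists because in the range \<open>C \<le> 1/\<alpha>\<close> the right-hand side increases in \<open>u\<close>
  with slope at least \<open>\<alpha>\<^sup>2\<close> (\<open>painleve_rhs_increasing\<close>). By the maximum principle
  (\<open>interval_max_principle\<close>) the difference of two such solutions on \<open>[-T, T]\<close> is at most the
  size of the perturbation divided by \<open>\<alpha>\<^sup>2\<close> plus the boundary difference damped by
  \<open>cosh (\<alpha> \<tau>) / cosh (\<alpha> T)\<close>. Comparison with an explicit subsolution first bounds \<open>u\<^sub>n\<close> below by
  a quantity that is linear in \<open>T\<close> and independent of \<open>n\<close>; then comparing \<open>u\<^sub>n\<close> with
  \<open>u\<^sub>m\<close> and choosing \<open>T\<close> large shows that \<open>u\<^sub>n(\<tau>)\<close> is a Cauchy sequence. As \<open>u\<^sub>n''\<close> is locally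
  bounded, \<open>u\<^sub>n'\<close> converges too, and to the derivative of the limit.

  Finally \<open>D\<^sub>n = \<Prod>\<^sub>j h\<^sub>j\<close>, so \<open>t d/dt ln D\<^sub>n = - t \<Sum>\<^sub>j C\<^sub>j(t)\<close>. By the
  formula for \<open>\<alpha>\<^sub>j\<close> this sum telescopes, and in terms of \<open>C\<^sub>n\<close> and \<open>u\<^sub>n'\<close> it is \<open>\<xi>\<close> times the
  integrand of the theorem plus terms that vanish as \<open>t \<rightarrow> 0\<close>
  (\<open>log_deriv_eq\<close>). After scaling, the logarithmic derivative is bounded by \<open>1 / (2 \<alpha>)\<close>
  uniformly, and dominated convergence gives the formula.
\<close>

section \<open>Orthogonal polynomials of an abstract moment sequence\<close>

text \<open>The integral of \<open>x\<^sup>j p(x)\<close>, expressed through the moments. The exponent \<open>j\<close> is an integer,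
  so that division by powers of \<open>x\<close> stays within polynomials.\<close>

definition mfun :: "(int \<Rightarrow> real) \<Rightarrow> int \<Rightarrow> real poly \<Rightarrow> real" where
  "mfun m j p = (\<Sum>i\<le>degree p. coeff p i * m (int i + j))"

lemma mfun_bound:
  assumes "degree p \<le> n"
  shows "mfun m j p = (\<Sum>i\<le>n. coeff p i * m (int i + j))"
  unfolding mfun_def
  by (rule sum.mono_neutral_left) (use assms in \<open>auto simp: coeff_eq_0\<close>)

lemma mfun_0 [simp]: "mfun m j 0 = 0"
  by (simp add: mfun_def)

lemma mfun_add: "mfun m j (p + q) = mfun m j p + mfun m j q"
proof -
  define n where "n = max (degree p) (degree q)"
  have "degree (p + q) \<le> n" "degree p \<le> n" "degree q \<le> n"
    by (auto simp: n_def intro: degree_add_le)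
  then show ?thesis
    by (simp add: mfun_bound[of _ n] sum.distrib algebra_simps)
qed

lemma mfun_smult: "mfun m j (Polynomial.smult c p) = c * mfun m j p"
  by (simp add: mfun_bound[OF degree_smult_le] mfun_def sum_distrib_left mult_ac)

lemma mfun_diff: "mfun m j (p - q) = mfun m j p - mfun m j q"
  using mfun_add[of m j "p - q" q] by simp

lemma mfun_sum: "mfun m j (\<Sum>i\<in>I. f i) = (\<Sum>i\<in>I. mfun m j (f i))"
  by (induction I rule: infinite_finite_induct) (auto simp: mfun_add)

lemma mfun_pCons: "mfun m j (pCons a p) = a * m j + mfun m (j + 1) p"
proof -
  have "mfun m j (pCons a p) = (\<Sum>i\<le>Suc (degree p). coeff (pCons a p) i * m (int i + j))"
    by (rule mfun_bound) (rule degree_pCons_le)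
  also have "\<dots> = a * m j + mfun m (j + 1) p"
    by (subst sum.atMost_Suc_shift) (simp add: mfun_def algebra_simps)
  finally show ?thesis .
qed

lemma mfun_X: "mfun m j ([:0, 1:] * p) = mfun m (j + 1) p"
  by (simp add: mfun_pCons)

lemma mfun_times_monom: "mfun m j (q * Polynomial.monom 1 l) = mfun m (j + int l) q"
proof (induction l arbitrary: j)
  case (Suc l)
  have "q * Polynomial.monom 1 (Suc l) = [:0,1:] * (q * Polynomial.monom 1 l)"
    by (simp add: monom_Suc)
  then show ?case by (simp only: mfun_X Suc) (simp add: algebra_simps)
qed (simp add: monom_0 flip: one_pCons)

text \<open>The recurrence itself serves as the definition, with its coefficients read off from the
  polynomials already built; continuity and differentiability in a parameter are then inherited step by step.\<close>

fun opoly :: "(int \<Rightarrow> real) \<Rightarrow> nat \<Rightarrow> real poly" where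
  "opoly m 0 = 1"
| "opoly m (Suc 0) = [:- (m 1 / m 0), 1:]"
| "opoly m (Suc (Suc n)) =
     [:- (mfun m 1 (opoly m (Suc n) * opoly m (Suc n)) / mfun m 0 (opoly m (Suc n) * opoly m (Suc n))), 1:]
        * opoly m (Suc n)
     - Polynomial.smult (mfun m 0 (opoly m (Suc n) * opoly m (Suc n)) / mfun m 0 (opoly m n * opoly m n))
        (opoly m n)"

definition hnorm :: "(int \<Rightarrow> real) \<Rightarrow> nat \<Rightarrow> real" where
  "hnorm m n = mfun m 0 (opoly m n * opoly m n)"

definition arec :: "(int \<Rightarrow> real) \<Rightarrow> nat \<Rightarrow> real" where
  "arec m n = mfun m 1 (opoly m n * opoly m n) / hnorm m n"

definition brec :: "(int \<Rightarrow> real) \<Rightarrow> nat \<Rightarrow> real" where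
  "brec m n = (if n = 0 then 0 else hnorm m n / hnorm m (n - 1))"

lemma opoly_rec:
  "[:0, 1:] * opoly m n = opoly m (Suc n) + Polynomial.smult (arec m n) (opoly m n)
     + Polynomial.smult (brec m n) (opoly m (n - 1))"
proof (cases n)
  case 0
  have "mfun m 1 1 = m 1" "mfun m 0 1 = m 0"
    by (simp_all add: mfun_def)
  then show ?thesis using 0 by (simp add: arec_def brec_def hnorm_def)
next
  case (Suc k)
  then show ?thesis
    by (simp add: arec_def brec_def hnorm_def)
qed

lemma opoly_monic: "degree (opoly m n) = n \<and> lead_coeff (opoly m n) = 1"
proof (induction n rule: less_induct)
  case (less n)
  show ?case
  proof (cases n)
    case 0 then show ?thesis by simp
  next
    case (Suc k)
    define c where "c = Polynomial.smult (arec m k) (opoly m k)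
      + Polynomial.smult (brec m k) (opoly m (k - 1))"
    have d: "degree (opoly m k) = k" "coeff (opoly m k) k = 1" "degree (opoly m (k-1)) = k - 1"
      using less[of k] less[of "k-1"] Suc by auto
    have "degree c \<le> k"
      unfolding c_def
      by (rule degree_add_le) (use d in \<open>auto intro: order.trans[OF degree_smult_le]\<close>)
    moreover have e: "opoly m n = [:0, 1:] * opoly m k - c"
      using opoly_rec[of m k] unfolding c_def Suc by (simp add: algebra_simps)
    have n0: "opoly m k \<noteq> 0" using d by auto
    have "degree ([:0, 1:] * opoly m k) = Suc k"
      using d n0 by (simp add: degree_pCons_eq)
    ultimately have c: "coeff (opoly m n) (Suc k) = 1" and "degree (opoly m n) \<le> Suc k"
      using d unfolding e by (auto simp: coeff_eq_0 intro!: degree_diff_le)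
    moreover have "degree (opoly m n) \<ge> Suc k"
      by (rule le_degree) (simp add: c)
    ultimately show ?thesis using Suc by simp
  qed
qed

declare opoly.simps(2,3) [simp del]

lemma degree_opoly [simp]: "degree (opoly m n) = n"
  and coeff_opoly [simp]: "coeff (opoly m n) n = 1"
  using opoly_monic[of m n] by auto

lemma opoly_nonzero [simp]: "opoly m n \<noteq> 0"
  using coeff_opoly[of m n] by fastforce

locale positive_moments =
  fixes m :: "int \<Rightarrow> real"
  assumes pos0: "p \<noteq> 0 \<Longrightarrow> 0 < mfun m 0 (p * p)"
begin

lemma hnorm_pos: "0 < hnorm m n"
  unfolding hnorm_def by (rule pos0) simp

text \<open>In pairing \<open>x P\<^sub>n\<close> with \<open>P\<^sub>k\<close> the factor \<open>x\<close> moves to \<open>P\<^sub>k\<close>, where the recurrence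
  reaches degree \<open>k + 1\<close> at most: only \<open>k = n\<close> and \<open>k = n - 1\<close> contribute, and these are cancelled
  by the choice of the two coefficients.\<close>

lemma opoly_orth_aux: "\<forall>i\<le>n. \<forall>k<i. mfun m 0 (opoly m i * opoly m k) = 0"
proof (induction n)
  case 0 then show ?case by simp
next
  case (Suc n)
  have orth: "mfun m 0 (opoly m i * opoly m k) = 0" if "i \<le> n" "k \<le> n" "i \<noteq> k" for i k
  proof (cases "k < i")
    case True then show ?thesis using Suc that by auto
  next
    case False
    then have "mfun m 0 (opoly m k * opoly m i) = 0" using Suc that by auto
    then show ?thesis by (simp add: mult.commute)
  qed
  have "mfun m 0 (opoly m (Suc n) * opoly m k) = 0" if "k \<le> n" for k
  proof -
    have e: "opoly m (Suc n) = [:0,1:] * opoly m n - Polynomial.smult (arec m n) (opoly m n)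
     - Polynomial.smult (brec m n) (opoly m (n - 1))"
      using opoly_rec[of m n] by (simp add: algebra_simps)
    have "mfun m 0 (opoly m (Suc n) * opoly m k) = mfun m 0 ([:0,1:] * (opoly m n * opoly m k))
       - arec m n * mfun m 0 (opoly m n * opoly m k) - brec m n * mfun m 0 (opoly m (n - 1) * opoly m k)"
      unfolding e left_diff_distrib mfun_diff mult_smult_left mfun_smult mult.assoc ..
    also have "\<dots> = 0"
    proof (cases "k = n")
      case True
      have "brec m n * mfun m 0 (opoly m (n - 1) * opoly m n) = 0"
        using orth[of "n-1" n] by (cases n) (auto simp: brec_def)
      then show ?thesis unfolding mfun_X True
        using hnorm_pos[of n] by (simp add: arec_def flip: hnorm_def)
    next
      case False
      then have k: "k < n" using that by simp
      have "mfun m 0 ([:0,1:] * (opoly m n * opoly m k)) = mfun m 0 (opoly m n * ([:0,1:] * opoly m k))"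
        by (simp add: mult.left_commute)
      also have "\<dots> = mfun m 0 (opoly m n * opoly m (Suc k)) + arec m k * mfun m 0 (opoly m n * opoly m k)
          + brec m k * mfun m 0 (opoly m n * opoly m (k-1))"
        unfolding opoly_rec distrib_left mfun_add mult_smult_right mfun_smult ..
      also have "\<dots> = mfun m 0 (opoly m n * opoly m (Suc k))"
        using orth[of n k] orth[of n "k-1"] k by simp
      finally have 1: "mfun m 0 ([:0,1:] * (opoly m n * opoly m k)) = mfun m 0 (opoly m n * opoly m (Suc k))" .
      have 2: "mfun m 0 (opoly m n * opoly m k) = 0" using orth k by simp
      show ?thesis
      proof (cases "Suc k = n")
        case True
        then have nk: "n - 1 = k" "n \<noteq> 0" "n = Suc k" by auto
        show ?thesis unfolding 1 2 using hnorm_pos[of k]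
          unfolding nk(1) nk(3) by (simp add: brec_def flip: hnorm_def)
      next
        case False
        then show ?thesis using 1 2 orth[of n "Suc k"] orth[of "n-1" k] k by simp
      qed
    qed
    finally show ?thesis .
  qed
  then show ?case using Suc by (auto simp: le_Suc_eq)
qed

lemma opoly_orth: "i \<noteq> k \<Longrightarrow> mfun m 0 (opoly m i * opoly m k) = 0"
  using opoly_orth_aux[of i] opoly_orth_aux[of k]
  by (metis linorder_neqE_nat mult.commute order_refl)

lemma monic_orthogonal_pairing:
  assumes deg: "\<And>n. degree (P n) = n" and lc: "\<And>n. coeff (P n) n = 1"
    and orth: "\<And>i k. i \<noteq> k \<Longrightarrow> mfun m 0 (P i * P k) = 0"
    and "degree r < n \<or> r = 0"
  shows "mfun m 0 (P n * r) = 0"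
  using assms(4)
proof (induction "degree r" arbitrary: r rule: less_induct)
  case (less r)
  show ?case
  proof (cases "r = 0")
    case False
    define d where "d = degree r"
    have dn: "d < n" using less.prems False d_def by simp
    define q' where "q' = r - Polynomial.smult (lead_coeff r) (P d)"
    have c0: "coeff q' d = 0" using lc[of d] by (simp add: q'_def d_def)
    have "degree q' \<le> d" unfolding q'_def
      by (rule degree_diff_le) (auto simp: d_def deg intro: order.trans[OF degree_smult_le])
    then have "degree q' < d \<or> q' = 0"
      using c0 by (metis leading_coeff_0_iff order_neq_le_trans)
    then have "mfun m 0 (P n * q') = 0"
      using less.hyps[of q'] dn d_def by fastforce
    moreover have "r = q' + Polynomial.smult (lead_coeff r) (P d)" by (simp add: q'_def)
    ultimately show ?thesis
      using orth[of n d] dn by (metis add.right_neutral distrib_left less_irrefl mfun_add mfun_smult mult_smult_right mult_zero_right)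
  qed simp
qed

lemma opoly_pairing_less:
  assumes "degree q < n \<or> q = 0"
  shows "mfun m 0 (opoly m n * q) = 0"
  by (rule monic_orthogonal_pairing[of "opoly m"]) (use assms opoly_orth in auto)

lemma opoly_pairing:
  assumes "degree q \<le> n"
  shows "mfun m 0 (opoly m n * q) = coeff q n * hnorm m n"
proof -
  define q' where "q' = q - Polynomial.smult (coeff q n) (opoly m n)"
  have "degree q' \<le> n" unfolding q'_def
    by (rule degree_diff_le) (use assms in \<open>auto intro: order.trans[OF degree_smult_le]\<close>)
  moreover have "coeff q' n = 0" by (simp add: q'_def)
  ultimately have "degree q' < n \<or> q' = 0"
    by (metis leading_coeff_0_iff order_neq_le_trans)
  then have "mfun m 0 (opoly m n * q') = 0" by (rule opoly_pairing_less)
  then show ?thesis by (simp add: q'_def right_diff_distrib mfun_diff mfun_smult hnorm_def)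
qed

lemma opoly_unique:
  assumes deg: "\<And>n. degree (P n) = n" and lc: "\<And>n. coeff (P n) n = 1"
    and orth: "\<And>i k. i \<noteq> k \<Longrightarrow> mfun m 0 (P i * P k) = 0"
  shows "P = opoly m"
proof
  fix n
  show "P n = opoly m n"
  proof (induction n rule: less_induct)
    case (less n)
    define q where "q = P n - opoly m n"
    have "degree q \<le> n" unfolding q_def by (rule degree_diff_le) (auto simp: deg)
    moreover have "coeff q n = 0" using lc[of n] by (simp add: q_def deg)
    ultimately have dq: "degree q < n \<or> q = 0" by (metis leading_coeff_0_iff order_neq_le_trans)
    have z: "mfun m 0 (P n * q) = 0"
      by (rule monic_orthogonal_pairing) (use deg lc orth dq in \<open>auto simp: deg\<close>)
    have "mfun m 0 (q * q) = mfun m 0 (P n * q) - mfun m 0 (opoly m n * q)"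
      by (simp add: q_def left_diff_distrib mfun_diff)
    also have "\<dots> = 0" using z opoly_pairing_less[OF dq] by simp
    finally have "q = 0" using pos0[of q] by (cases "q = 0") auto
    then show ?case by (simp add: q_def)
  qed
qed

text \<open>The coefficient matrix of the orthogonal polynomials is lower unitriangular and
  transforms the Hankel matrix, by congruence, into the diagonal matrix of the squared norms.\<close>

lemma det_hankel:
  "Determinant.det (mat n n (\<lambda>(j, k). m (int (j + k)))) = (\<Prod>j<n. hnorm m j)"
proof -
  define U where "U = mat n n (\<lambda>(i, j). coeff (opoly m i) j)"
  define H where "H = mat n n (\<lambda>(j, k). m (int (j + k)))"
  define Dg where "Dg = mat n n (\<lambda>(i, j). if i = j then hnorm m i else 0)"
  have [simp]: "U \<in> carrier_mat n n" "H \<in> carrier_mat n n" "Dg \<in> carrier_mat n n"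
    by (auto simp: U_def H_def Dg_def)
  have "det U = prod_list (diag_mat U)"
    by (rule det_lower_triangular[of n]) (auto simp: U_def intro: coeff_eq_0)
  also have "diag_mat U = map (\<lambda>i. 1) [0..<n]"
    unfolding diag_mat_def by (rule map_cong) (auto simp: U_def)
  finally have dU: "det U = 1" by (simp add: prod_list_replicate map_replicate_const)
  have "det Dg = prod_list (diag_mat Dg)"
    by (rule det_lower_triangular[of n]) (auto simp: Dg_def)
  also have "diag_mat Dg = map (\<lambda>i. hnorm m i) [0..<n]"
    unfolding diag_mat_def by (rule map_cong) (auto simp: Dg_def)
  finally have dD: "det Dg = (\<Prod>j<n. hnorm m j)"
    using prod.distinct_set_conv_list[of "[0..<n]" "hnorm m"] by (simp add: atLeast0LessThan)
  have "U * H * U\<^sup>T = Dg"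
  proof (rule eq_matI)
    fix i j assume "i < dim_row Dg" "j < dim_col Dg"
    then have ij: "i < n" "j < n" by (auto simp: Dg_def)
    have "(U * H * U\<^sup>T) $$ (i, j)
        = (\<Sum>l<n. (\<Sum>k<n. coeff (opoly m i) k * m (int (k + l))) * coeff (opoly m j) l)"
      using ij by (simp add: U_def H_def scalar_prod_def atLeast0LessThan)
    also have "\<dots> = (\<Sum>l<n. mfun m 0 (opoly m i * Polynomial.monom 1 l) * coeff (opoly m j) l)"
    proof (rule sum.cong[OF refl])
      fix l assume "l \<in> {..<n}"
      have "mfun m 0 (opoly m i * Polynomial.monom 1 l) = mfun m (int l) (opoly m i)"
        by (simp add: mfun_times_monom)
      moreover have "degree (opoly m i) \<le> n - 1" using ij by simp
      moreover have "{..n-1} = {..<n}" using ij by auto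
      ultimately show "(\<Sum>k<n. coeff (opoly m i) k * m (int (k + l))) * coeff (opoly m j) l
        = mfun m 0 (opoly m i * Polynomial.monom 1 l) * coeff (opoly m j) l"
        by (simp add: mfun_bound[of _ "n-1"])
    qed
    also have "\<dots> = mfun m 0 (opoly m i * (\<Sum>l<n. Polynomial.smult (coeff (opoly m j) l) (Polynomial.monom 1 l)))"
      by (simp add: sum_distrib_left mfun_sum mfun_smult mult_ac)
    also have "(\<Sum>l<n. Polynomial.smult (coeff (opoly m j) l) (Polynomial.monom 1 l)) = opoly m j"
    proof -
      have "{..n-1} = {..<n}" using ij by auto
      then show ?thesis
        using poly_as_sum_of_monoms'[of "opoly m j" "n - 1"] ij by (simp add: smult_monom)
    qed
    also have "mfun m 0 (opoly m i * opoly m j) = Dg $$ (i, j)"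
      using ij opoly_orth[of i j] by (simp add: Dg_def hnorm_def)
    finally show "(U * H * U\<^sup>T) $$ (i, j) = Dg $$ (i, j)" .
  qed (auto simp: U_def Dg_def)
  moreover have "det (U * H * U\<^sup>T) = det H"
  proof -
    have "det (U * H * U\<^sup>T) = det (U * H) * det U\<^sup>T"
      by (rule det_mult[of _ n]) (rule mult_carrier_mat[of U n n H n], auto)
    also have "\<dots> = det H"
      using dU det_mult[of U n H] det_transpose[of U n] by simp
    finally show ?thesis .
  qed
  ultimately show ?thesis using dD H_def by simp
qed

end

section \<open>Algebraic identities at fixed time\<close>

lemma poly_div_X: "(p :: real poly) = [:coeff p 0:] + [:0, 1:] * poly_shift 1 p"
  by (rule poly_eqI) (simp add: coeff_poly_shift coeff_pCons split: nat.split)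

lemma degree_poly_shift_1: "degree (poly_shift 1 p) \<le> degree p - 1" 
  by (rule degree_le) (auto simp: coeff_poly_shift coeff_eq_0)

lemma numeral_mult_poly: "numeral k * (p :: real poly) = Polynomial.smult (numeral k) p"
  "p * numeral k = Polynomial.smult (numeral k) p"
  by (simp_all add: numeral_poly)

text \<open>The auxiliary quantities of the ladder operator formalism: \<open>t\<close> times the first is \<open>R\<^sub>n\<close>, the
  second is \<open>r\<^sub>n\<close>.\<close>

definition inv_mean :: "(int \<Rightarrow> real) \<Rightarrow> nat \<Rightarrow> real" where
  "inv_mean m n = mfun m (-1) (opoly m n * opoly m n) / hnorm m n"

definition inv_cross :: "(int \<Rightarrow> real) \<Rightarrow> real \<Rightarrow> nat \<Rightarrow> real" where
  "inv_cross m t n = t * mfun m (-1) (opoly m n * opoly m (n - 1)) / hnorm m (n - 1)"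

text \<open>Only positivity and the recurrence expressing that \<open>(x\<^sup>k w)'\<close> integrates to zero
  are retained of the weight.\<close>

locale laguerre_moments =
  fixes m :: "int \<Rightarrow> real" and \<alpha> t :: real
  assumes pos: "p \<noteq> 0 \<Longrightarrow> 0 < mfun m j (p * p)"
    and moment_rec: "m k = (of_int k + \<alpha>) * m (k - 1) + t * m (k - 2)"
    and alpha_pos: "0 < \<alpha>" and t_pos: "0 < t"

sublocale laguerre_moments \<subseteq> positive_moments m
  by unfold_locales (rule pos)

context laguerre_moments
begin

lemma mfun_by_parts:
  "mfun m j (pderiv p) + (of_int j + \<alpha>) * mfun m (j - 1) p + t * mfun m (j - 2) p = mfun m j p"
proof (induction p arbitrary: j)
  case (pCons a p)
  have "mfun m j (pderiv (pCons a p)) = mfun m j p + mfun m (j + 1) (pderiv p)"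
    by (simp add: pderiv_pCons mfun_add mfun_pCons)
  moreover have "mfun m (j + 1) (pderiv p) + (of_int (j + 1) + \<alpha>) * mfun m j p + t * mfun m (j - 1) p
      = mfun m (j + 1) p"
    using pCons(2)[of "j + 1"] by simp
  ultimately show ?case
    using moment_rec[of j] by (simp add: mfun_pCons algebra_simps)
qed simp

abbreviation "Pn \<equiv> opoly m"
abbreviation "hn \<equiv> hnorm m"

abbreviation "cpot \<equiv> inv_mean m"
abbreviation "rvar \<equiv> inv_cross m t"
abbreviation "p1 n \<equiv> coeff (opoly m n) (n - 1)"

lemma cpot_pos: "0 < cpot n"
  unfolding inv_mean_def using hnorm_pos pos[of "Pn n" "-1"] by simp

text \<open>Write \<open>q = q(0) + x q\<^sub>1\<close>: the second part, divided by \<open>x\<close>, has degree below \<open>n\<close> and is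
  orthogonal to \<open>P\<^sub>n\<close>.\<close>

lemma pairing_inv:
  assumes "degree q \<le> n"
  shows "mfun m (-1) (Pn n * q) = coeff q 0 * mfun m (-1) (Pn n)"
proof -
  have q: "Pn n * q = Polynomial.smult (coeff q 0) (Pn n) + [:0,1:] * (Pn n * poly_shift 1 q)"
    by (subst (1) poly_div_X[of q]) (simp add: algebra_simps)
  have "degree (poly_shift 1 q) < n \<or> poly_shift 1 q = 0"
  proof (cases "n = 0")
    case True
    then have "poly_shift 1 q = 0" using assms
      by (intro poly_eqI) (auto simp: coeff_poly_shift coeff_eq_0)
    then show ?thesis by simp
  qed (use assms degree_poly_shift_1[of q] in linarith)
  then have "mfun m 0 (Pn n * poly_shift 1 q) = 0" by (rule opoly_pairing_less)
  then show ?thesis unfolding q mfun_add mfun_smult mfun_X by simp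
qed

lemma pairing_inv2:
  assumes "degree q \<le> n"
  shows "mfun m (-2) (Pn n * q) = coeff q 0 * mfun m (-2) (Pn n) + coeff q 1 * mfun m (-1) (Pn n)"
proof -
  have q: "Pn n * q = Polynomial.smult (coeff q 0) (Pn n) + [:0,1:] * (Pn n * poly_shift 1 q)"
    by (subst (1) poly_div_X[of q]) (simp add: algebra_simps)
  have "degree (poly_shift 1 q) \<le> n" using degree_poly_shift_1[of q] assms by simp
  then have "mfun m (-1) (Pn n * poly_shift 1 q) = coeff q 1 * mfun m (-1) (Pn n)"
    by (simp add: pairing_inv coeff_poly_shift)
  then show ?thesis unfolding q mfun_add mfun_smult mfun_X by simp
qed

text \<open>Here \<open>P\<^sub>n\<close>, rather than \<open>P\<^sub>n\<^sub>-\<^sub>1\<close>, is divided by \<open>x\<close>; the quotient is monic of degree \<open>n - 1\<close>,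
  which yields the norm. Comparison with \<open>pairing_inv\<close> is the source of the quadratic identities.\<close>

lemma pairing_inv_prev:
  assumes "0 < n"
  shows "mfun m (-1) (Pn n * Pn (n - 1)) = coeff (Pn n) 0 * mfun m (-1) (Pn (n - 1)) + hn (n - 1)"
proof -
  define q where "q = poly_shift 1 (Pn n)"
  have "Pn n * Pn (n - 1) = Polynomial.smult (coeff (Pn n) 0) (Pn (n - 1)) + [:0,1:] * (Pn (n - 1) * q)"
    by (subst (1) poly_div_X[of "Pn n"]) (simp add: algebra_simps q_def)
  moreover have "degree q \<le> n - 1" using degree_poly_shift_1[of "Pn n"] by (simp add: q_def)
  then have "mfun m 0 (Pn (n - 1) * q) = hn (n - 1)"
    using assms by (simp add: opoly_pairing q_def coeff_poly_shift)
  ultimately show ?thesis by (simp only: mfun_add mfun_smult mfun_X) simp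
qed

lemma pairing_inv2_prev:
  assumes "0 < n"
  shows "mfun m (-2) (Pn n * Pn (n - 1))
    = coeff (Pn n) 0 * mfun m (-2) (Pn (n - 1)) + coeff (Pn n) 1 * mfun m (-1) (Pn (n - 1))"
proof -
  define q where "q = poly_shift 1 (Pn n)"
  define q' where "q' = poly_shift 1 q"
  have e: "Pn n * Pn (n - 1) = Polynomial.smult (coeff (Pn n) 0) (Pn (n - 1)) + [:0,1:] * (Pn (n - 1) * q)"
    by (subst (1) poly_div_X[of "Pn n"]) (simp add: algebra_simps q_def)
  have e': "Pn (n - 1) * q = Polynomial.smult (coeff q 0) (Pn (n - 1)) + [:0,1:] * (Pn (n - 1) * q')"
    by (subst (1) poly_div_X[of q]) (simp add: algebra_simps q'_def)
  have "degree q' < n - 1 \<or> q' = 0"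
  proof (cases "n \<le> 1")
    case True
    then have "q' = 0" by (intro poly_eqI) (auto simp: q'_def q_def coeff_poly_shift coeff_eq_0)
    then show ?thesis by simp
  next
    case False
    have "degree q' \<le> n - 2"
      by (rule degree_le) (auto simp: q'_def q_def coeff_poly_shift coeff_eq_0)
    then show ?thesis using False by linarith
  qed
  then have "mfun m 0 (Pn (n - 1) * q') = 0" by (rule opoly_pairing_less)
  moreover have "coeff q 0 = coeff (Pn n) 1" by (simp add: q_def coeff_poly_shift)
  ultimately have "mfun m (-1) (Pn (n - 1) * q) = coeff (Pn n) 1 * mfun m (-1) (Pn (n - 1))"
    unfolding e' mfun_add mfun_smult mfun_X by simp
  then show ?thesis unfolding e mfun_add mfun_smult mfun_X by simp
qed

text \<open>Integration of \<open>(x P\<^sub>n\<^sup>2 w)'\<close>.\<close>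

lemma arec_eq: "arec m n = 2 * real n + 1 + \<alpha> + t * cpot n"
proof -
  let ?q = "Pn n * Pn n"
  have "mfun m 1 (pderiv ?q) = mfun m 0 (Pn n * Polynomial.smult 2 ([:0,1:] * pderiv (Pn n)))"
  proof -
    have "mfun m 1 (pderiv ?q) = mfun m 0 ([:0,1:] * pderiv ?q)" by (simp only: mfun_X) simp
    also have "[:0,1:] * pderiv ?q = Pn n * Polynomial.smult 2 ([:0,1:] * pderiv (Pn n))"
      by (simp add: pderiv_mult algebra_simps numeral_mult_poly)
    finally show ?thesis .
  qed
  also have "\<dots> = 2 * real n * hn n"
  proof (subst opoly_pairing)
    have "degree (pderiv (Pn n)) = n - 1" by (simp add: degree_pderiv)
    then show "degree (Polynomial.smult 2 ([:0,1:] * pderiv (Pn n))) \<le> n"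
      by (cases "pderiv (Pn n) = 0"; cases n) (auto simp: pderiv_eq_0_iff)
    show "coeff (Polynomial.smult 2 ([:0, 1:] * pderiv (Pn n))) n * hn n = 2 * real n * hn n"
      by (cases n) (auto simp: coeff_pderiv)
  qed
  finally have "mfun m 1 (pderiv ?q) = 2 * real n * hn n" .
  then have "2 * real n * hn n + (1 + \<alpha>) * hn n + t * mfun m (-1) ?q = mfun m 1 ?q"
    using mfun_by_parts[of 1 ?q] by (simp add: hnorm_def)
  then show ?thesis using hnorm_pos[of n] by (simp add: arec_def inv_mean_def field_simps)
qed

text \<open>Integration of \<open>(P\<^sub>n\<^sup>2 w)'\<close>.\<close>

lemma cpot_diag: "\<alpha> * mfun m (-1) (Pn n * Pn n) + t * mfun m (-2) (Pn n * Pn n) = hn n"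
proof -
  have "mfun m 0 (pderiv (Pn n * Pn n)) = 2 * mfun m 0 (Pn n * pderiv (Pn n))"
    by (simp add: pderiv_mult mfun_add mult.commute numeral_mult_poly mfun_smult)
  also have "mfun m 0 (Pn n * pderiv (Pn n)) = 0"
    by (rule opoly_pairing_less) (auto simp: degree_pderiv pderiv_eq_0_iff)
  finally show ?thesis using mfun_by_parts[of 0 "Pn n * Pn n"] by (simp add: hnorm_def)
qed

lemma cpot_le: "cpot n \<le> 1 / \<alpha>"
proof -
  have "0 < mfun m (-2) (Pn n * Pn n)" by (rule pos) simp
  then have "\<alpha> * mfun m (-1) (Pn n * Pn n) \<le> hn n"
    using cpot_diag[of n] t_pos mult_pos_pos[of t "mfun m (-2) (Pn n * Pn n)"] by linarith
  then show ?thesis using alpha_pos hnorm_pos[of n] by (simp add: inv_mean_def field_simps)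
qed

text \<open>Cauchy-Schwarz: \<open>\<langle>P\<^sub>n\<^sup>2\<rangle>\<^sup>2 \<le> \<langle>x P\<^sub>n\<^sup>2\<rangle> \<langle>P\<^sub>n\<^sup>2 / x\<rangle>\<close>, in the form of positivity of
  \<open>\<langle>(x - c)\<^sup>2 P\<^sub>n\<^sup>2 / x\<rangle>\<close> at \<open>c = \<alpha>\<^sub>n\<close>. The bound degenerates as \<open>n\<close> grows; it is used only as a
  boundary value, where it is damped.\<close>

lemma cpot_ge: "1 / (2 * real n + 1 + \<alpha> + t / \<alpha>) \<le> cpot n"
proof -
  define c where "c = arec m n"
  have "0 < mfun m (-1) (([:- c, 1:] * Pn n) * ([:- c, 1:] * Pn n))"
    by (rule pos) (metis mult_eq_0_iff one_neq_zero opoly_nonzero pCons_eq_0_iff)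
  also have "([:- c, 1:] * Pn n) * ([:- c, 1:] * Pn n)
     = [:0,1:] * ([:0,1:] * (Pn n * Pn n)) - Polynomial.smult (2 * c) ([:0,1:] * (Pn n * Pn n))
       + Polynomial.smult (c\<^sup>2) (Pn n * Pn n)"
    by (simp add: algebra_simps power2_eq_square numeral_mult_poly)
  also have "mfun m (-1) \<dots> = mfun m 1 (Pn n * Pn n) - 2 * c * hn n + c\<^sup>2 * mfun m (-1) (Pn n * Pn n)"
    by (simp only: mfun_add mfun_diff mfun_smult mfun_X hnorm_def) simp
  also have "\<dots> = hn n * (c\<^sup>2 * cpot n - c)"
    using hnorm_pos[of n] by (simp add: c_def arec_def inv_mean_def field_simps power2_eq_square)
  finally have "0 < c\<^sup>2 * cpot n - c"
    using hnorm_pos[of n] by (simp add: zero_less_mult_iff)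
  then have "0 < c * (c * cpot n - 1)" by (simp add: power2_eq_square algebra_simps)
  moreover have c0: "0 < c" using arec_eq[of n] cpot_pos[of n] t_pos alpha_pos
    by (simp add: c_def add_pos_pos)
  ultimately have "1 / c < cpot n" by (simp add: zero_less_mult_iff field_simps)
  moreover have "c \<le> 2 * real n + 1 + \<alpha> + t / \<alpha>"
    using arec_eq[of n] mult_left_mono[OF cpot_le[of n], of t] t_pos by (simp add: c_def)
  then have "1 / (2 * real n + 1 + \<alpha> + t / \<alpha>) \<le> 1 / c" using c0 by (simp add: frac_le)
  ultimately show ?thesis by linarith
qed

lemma p1_diff: "0 < n \<Longrightarrow> p1 (Suc n) = p1 n - arec m n"
proof -
  assume n: "0 < n"
  then obtain k where k: "n = Suc k" by (cases n) auto
  have "coeff ([:0, 1:] * opoly m n) n = coeff (opoly m (Suc n)) n + arec m n * coeff (opoly m n) n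
    + brec m n * coeff (opoly m (n - 1)) n"
    unfolding opoly_rec by (simp add: k)
  then show ?thesis using k by (simp add: coeff_eq_0)
qed

lemma rvar_Suc: "0 < n \<Longrightarrow> rvar (Suc n) + rvar n = t - arec m n * (t * cpot n)"
proof -
  assume n: "0 < n"
  have "mfun m (-1) (([:0, 1:] * opoly m n) * opoly m n) = mfun m (-1) (Pn (Suc n) * Pn n)
    + arec m n * mfun m (-1) (Pn n * Pn n) + brec m n * mfun m (-1) (Pn (n - 1) * Pn n)"
    unfolding opoly_rec distrib_right mfun_add mult_smult_left mfun_smult ..
  also have "mfun m (-1) (([:0, 1:] * opoly m n) * opoly m n) = hn n"
    by (simp only: mult.assoc mfun_X hnorm_def) simp
  finally have *: "hn n = mfun m (-1) (Pn (Suc n) * Pn n)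
    + arec m n * mfun m (-1) (Pn n * Pn n) + brec m n * mfun m (-1) (Pn (n - 1) * Pn n)" .
  have "rvar (Suc n) + rvar n = t * (mfun m (-1) (Pn (Suc n) * Pn n) + brec m n * mfun m (-1) (Pn (n - 1) * Pn n)) / hn n"
    using n hnorm_pos[of n] hnorm_pos[of "n-1"]
    by (simp add: inv_cross_def brec_def field_simps)
  also have "\<dots> = t * (hn n - arec m n * mfun m (-1) (Pn n * Pn n)) / hn n"
    using * by simp
  also have "\<dots> = t - arec m n * (t * cpot n)"
    using hnorm_pos[of n] by (simp add: inv_mean_def field_simps)
  finally show ?thesis .
qed

text \<open>Integration of \<open>(x P\<^sub>n P\<^sub>n\<^sub>-\<^sub>1 w)'\<close>, where \<open>x P\<^sub>n' = n P\<^sub>n - p\<^sub>n x\<^sup>n\<^sup>-\<^sup>1 + \<dots>\<close>.\<close>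

lemma brec_eq: "0 < n \<Longrightarrow> brec m n = rvar n - p1 n"
proof -
  assume n: "0 < n"
  let ?q = "Pn n * Pn (n - 1)"
  have "mfun m 1 (pderiv ?q) = mfun m 0 (Pn n * ([:0,1:] * pderiv (Pn (n - 1)))) + mfun m 0 (Pn (n - 1) * ([:0,1:] * pderiv (Pn n)))"
  proof -
    have "mfun m 1 (pderiv ?q) = mfun m 0 ([:0,1:] * pderiv ?q)" by (simp only: mfun_X) simp
    also have "[:0,1:] * pderiv ?q = Pn n * ([:0,1:] * pderiv (Pn (n - 1))) + Pn (n - 1) * ([:0,1:] * pderiv (Pn n))"
      by (simp add: pderiv_mult algebra_simps) 
    finally show ?thesis by (simp only: mfun_add)
  qed
  also have "mfun m 0 (Pn n * ([:0,1:] * pderiv (Pn (n - 1)))) = 0"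
  proof (rule opoly_pairing_less)
    have "degree (pderiv (Pn (n-1))) = n - 2" by (simp add: degree_pderiv)
    then show "degree ([:0,1:] * pderiv (Pn (n-1))) < n \<or> [:0,1:] * pderiv (Pn (n-1)) = 0"
      using n by (cases "pderiv (Pn (n-1)) = 0") (auto simp: pderiv_eq_0_iff)
  qed
  also have "mfun m 0 (Pn (n - 1) * ([:0,1:] * pderiv (Pn n))) = - p1 n * hn (n - 1)"
  proof -
    define q where "q = [:0,1:] * pderiv (Pn n) - Polynomial.smult (real n) (Pn n)"
    have "degree (pderiv (Pn n)) = n - 1" by (simp add: degree_pderiv)
    then have "degree q \<le> n" unfolding q_def using n
      by (intro degree_diff_le) (auto intro: order.trans[OF degree_pCons_le] order.trans[OF degree_smult_le])
    moreover have "coeff q n = 0" using n by (cases n) (auto simp: q_def coeff_pderiv)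
    ultimately have "degree q < n \<or> q = 0" by (metis leading_coeff_0_iff order_neq_le_trans)
    then have dq: "degree q \<le> n - 1" by auto
    have "coeff q (n - 1) = - p1 n"
      using n by (cases n; cases "n - 1") (auto simp: q_def coeff_pderiv coeff_pCons algebra_simps)
    then have "mfun m 0 (Pn (n - 1) * q) = - p1 n * hn (n - 1)" using opoly_pairing[OF dq] by simp
    moreover have "[:0,1:] * pderiv (Pn n) = q + Polynomial.smult (real n) (Pn n)" by (simp add: q_def)
    moreover have "mfun m 0 (Pn (n - 1) * Pn n) = 0" using n by (intro opoly_orth) auto
    ultimately show ?thesis by (simp only: distrib_left mfun_add mult_smult_right mfun_smult)
  qed
  finally have 1: "mfun m 1 (pderiv ?q) = - p1 n * hn (n - 1)" by simp
  have 2: "mfun m 0 ?q = 0" using n by (intro opoly_orth) auto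
  have "mfun m 1 ?q = mfun m 0 (Pn n * ([:0,1:] * Pn (n - 1)))"
    by (simp add: mult.left_commute[of "Pn n"] mfun_pCons)
  also have "\<dots> = hn n"
    using n by (subst opoly_pairing) (auto simp: coeff_pCons split: nat.splits)
  finally have 3: "mfun m 1 ?q = hn n" .
  have "- p1 n * hn (n - 1) + t * mfun m (-1) ?q = hn n"
    using mfun_by_parts[of 1 ?q] 1 2 3 by simp
  then show ?thesis using n hnorm_pos[of "n - 1"] by (simp add: brec_def inv_cross_def field_simps)
qed

text \<open>With \<open>a = P\<^sub>n(0)\<close>, \<open>b = P\<^sub>n\<^sub>-\<^sub>1(0)\<close>, \<open>A = \<langle>P\<^sub>n / x\<rangle>\<close>, \<open>B = \<langle>P\<^sub>n\<^sub>-\<^sub>1 / x\<rangle>\<close>, all means of \<open>1/x\<close>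
  factor: \<open>R\<^sub>n\<close>, \<open>R\<^sub>n\<^sub>-\<^sub>1\<close>, \<open>r\<^sub>n\<close> and \<open>r\<^sub>n - t\<close> are multiples of \<open>aA\<close>, \<open>bB\<close>, \<open>bA\<close> and \<open>aB\<close>,
  so the first identity is \<open>(bA)(aB) = (aA)(bB)\<close>. The second follows from the derivatives of
  \<open>P\<^sub>n\<^sup>2 w\<close>, \<open>P\<^sub>n P\<^sub>n\<^sub>-\<^sub>1 w\<close> and \<open>P\<^sub>n\<^sub>-\<^sub>1\<^sup>2 w\<close>: the unknown means of \<open>1/x\<^sup>2\<close> and linear coefficients
  enter only through one determinant \<open>a b' - a' b\<close>, which is then eliminated. These are the
  compatibility conditions of the ladder operators.\<close>

lemma rvar_quadratic:
  assumes n: "0 < n"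
  shows "(rvar n)\<^sup>2 - t * rvar n = brec m n * (t * cpot n) * (t * cpot (n - 1))"
    and "real n * (rvar n - t) + (real n + \<alpha>) * rvar n + brec m n * (t * cpot n + t * cpot (n - 1)) = 0"
proof -
  define a b a' b' where "a = coeff (Pn n) 0" and "b = coeff (Pn (n - 1)) 0"
    and "a' = coeff (Pn n) 1" and "b' = coeff (Pn (n - 1)) 1"
  define A B A' B' where "A = mfun m (-1) (Pn n)" and "B = mfun m (-1) (Pn (n - 1))"
    and "A' = mfun m (-2) (Pn n)" and "B' = mfun m (-2) (Pn (n - 1))"
  define h k where "h = hn n" and "k = hn (n - 1)"
  have h: "0 < h" "0 < k" using hnorm_pos by (auto simp: h_def k_def)
  have nn: "mfun m (-1) (Pn n * Pn n) = a * A"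
    unfolding a_def A_def by (simp add: pairing_inv)
  have np: "mfun m (-1) (Pn n * Pn (n - 1)) = b * A"
    unfolding b_def A_def by (simp add: pairing_inv)
  have np': "mfun m (-1) (Pn n * Pn (n - 1)) = a * B + k"
    unfolding a_def B_def k_def using pairing_inv_prev[OF n] by simp
  have pp: "mfun m (-1) (Pn (n - 1) * Pn (n - 1)) = b * B"
    unfolding b_def B_def by (simp add: pairing_inv)
  have r: "rvar n = t * b * A / k" "rvar n = t * (a * B + k) / k"
    unfolding inv_cross_def using np np' by (auto simp: k_def)
  have c: "cpot n = a * A / h" "cpot (n - 1) = b * B / k"
    unfolding inv_mean_def using nn pp by (auto simp: h_def k_def)
  have be: "brec m n = h / k" using n by (simp add: brec_def h_def k_def)
  have rt: "rvar n - t = t * a * B / k" using h by (simp add: r(2) field_simps)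
  have "(rvar n)\<^sup>2 - t * rvar n = rvar n * (rvar n - t)" by (simp add: power2_eq_square algebra_simps)
  also have "\<dots> = (t * b * A / k) * (t * a * B / k)" using r(1) rt by simp
  also have "\<dots> = brec m n * (t * cpot n) * (t * cpot (n - 1))"
    unfolding be c using h by (simp add: field_simps)
  finally show "(rvar n)\<^sup>2 - t * rvar n = brec m n * (t * cpot n) * (t * cpot (n - 1))" .
  have i1: "\<alpha> * (a * A) + t * (a * A' + a' * A) = h"
    using cpot_diag[of n] by (simp add: nn pairing_inv2 a_def A'_def a'_def A_def h_def)
  have i3: "\<alpha> * (b * B) + t * (b * B' + b' * B) = k"
    using cpot_diag[of "n - 1"] pp pairing_inv2[of "Pn (n - 1)" "n - 1"]
    by (simp add: b_def B'_def b'_def B_def k_def)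
  have "mfun m 0 (pderiv (Pn n * Pn (n - 1))) = real n * k"
  proof -
    have "mfun m 0 (Pn n * pderiv (Pn (n - 1))) = 0"
      by (rule opoly_pairing_less) (use n in \<open>auto simp: degree_pderiv pderiv_eq_0_iff\<close>)
    moreover have "mfun m 0 (Pn (n - 1) * pderiv (Pn n)) = real n * k"
      using n by (subst opoly_pairing) (auto simp: degree_pderiv coeff_pderiv k_def)
    ultimately show ?thesis by (simp add: pderiv_mult mfun_add)
  qed
  moreover have "mfun m 0 (Pn n * Pn (n - 1)) = 0" using n by (intro opoly_orth) auto
  ultimately have i: "real n * k + \<alpha> * (b * A) + t * mfun m (-2) (Pn n * Pn (n - 1)) = 0"
    using mfun_by_parts[of 0 "Pn n * Pn (n - 1)"] np by simp
  have i2: "real n * k + \<alpha> * (b * A) + t * (b * A' + b' * A) = 0"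
    using i by (simp add: pairing_inv2 b_def A'_def b'_def A_def)
  have i4: "real n * k + \<alpha> * (b * A) + t * (a * B' + a' * B) = 0"
    using i pairing_inv2_prev[OF n] by (simp add: a_def B'_def a'_def B_def)
  have bA: "b * A = a * B + k" using np np' by simp
  \<comment> \<open>Each pair of relations fixes the determinant \<open>a b' - a' b\<close>, with factor \<open>A\<close> or \<open>B\<close>.\<close>
  have w1: "t * A * (a * b' - a' * b) = - (h * b + real n * k * a)"
  proof -
    have "t * A * (a * b' - a' * b) = a * (real n * k + \<alpha> * (b * A) + t * (b * A' + b' * A))
        - b * (\<alpha> * (a * A) + t * (a * A' + a' * A)) - real n * k * a"
      by (simp add: algebra_simps)
    then show ?thesis unfolding i1 i2 by (simp add: algebra_simps)
  qed
  have w2: "t * B * (a * b' - a' * b) = k * (a + (real n + \<alpha>) * b)"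
  proof -
    have "t * B * (a * b' - a' * b) = a * (\<alpha> * (b * B) + t * (b * B' + b' * B))
        - b * (real n * k + \<alpha> * (b * A) + t * (a * B' + a' * B)) + real n * k * b + \<alpha> * b * (b * A - a * B)"
      by (simp add: algebra_simps)
    then show ?thesis unfolding i3 i4 unfolding bA by (simp add: algebra_simps)
  qed
  have "(h * b + real n * k * a) * B + k * (a + (real n + \<alpha>) * b) * A = 0"
  proof -
    have e: "h * b + real n * k * a = - (t * A * (a * b' - a' * b))"
      and e': "k * (a + (real n + \<alpha>) * b) = t * B * (a * b' - a' * b)"
      using w1 w2 by simp_all
    show ?thesis unfolding e e' by simp
  qed
  then have z: "t * ((h * b + real n * k * a) * B + k * (a + (real n + \<alpha>) * b) * A) / (k * k) = 0"
    by simp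
  have "real n * (rvar n - t) + (real n + \<alpha>) * rvar n + brec m n * (t * cpot n + t * cpot (n - 1))
     = real n * (t * a * B / k) + (real n + \<alpha>) * (t * b * A / k) + h / k * (t * (a * A / h) + t * (b * B / k))"
    unfolding rt be c using r(1) by simp
  also have "\<dots> = t * ((h * b + real n * k * a) * B + k * (a + (real n + \<alpha>) * b) * A) / (k * k)"
    using h by (simp add: field_simps)
  finally show "real n * (rvar n - t) + (real n + \<alpha>) * rvar n + brec m n * (t * cpot n + t * cpot (n - 1)) = 0"
    using z by simp
qed

text \<open>By \<open>arec_eq\<close> a sum of recurrence coefficients, which telescopes since \<open>\<alpha>\<^sub>j\<close> is the difference
  of consecutive subleading coefficients.\<close>

lemma sum_cpot: "0 < n \<Longrightarrow> - t * (\<Sum>j<n. cpot j) = p1 n + real n * (real n + \<alpha>)"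
proof (induction n)
  case (Suc n)
  show ?case
  proof (cases "n = 0")
    case True
    have "p1 1 = - arec m 0" by (simp add: arec_def hnorm_def mfun_def opoly.simps)
    then show ?thesis using True arec_eq[of 0] by simp
  next
    case False
    then show ?thesis using Suc p1_diff[of n] arec_eq[of n] by (simp add: algebra_simps)
  qed
qed simp

end

section \<open>Moments of the perturbed Laguerre weight\<close>

definition kern :: "real \<Rightarrow> real \<Rightarrow> real \<Rightarrow> real" where
  "kern t a x = x powr a * exp (- x - t / x)"

text \<open>Equal to \<open>2 t\<^bsup>(a+1)/2\<^esup> K\<^bsub>a+1\<^esub>(2 \<surd>t)\<close> for \<open>t > 0\<close>; a real exponent \<open>a\<close> treats the power of the
  weight and the index of the moment at once.\<close>

definition bessel_int :: "real \<Rightarrow> real \<Rightarrow> real" where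
  "bessel_int t a = (LINT x:{0<..}|lborel. kern t a x)"

lemma kern_nonneg [simp]: "0 \<le> kern t a x"
  by (simp add: kern_def)

lemma kern_pos: "0 < x \<Longrightarrow> 0 < kern t a x"
  by (simp add: kern_def)

lemma kern_measurable [measurable]: "kern t a \<in> borel_measurable borel"
  unfolding kern_def by measurable

lemma kern_shift: "0 < x \<Longrightarrow> x ^ k * kern t a x = kern t (a + real k) x"
  by (simp add: kern_def powr_add powr_realpow)

lemma kern_minus_one: "0 < x \<Longrightarrow> kern t (a - 1) x = kern t a x / x"
  by (simp add: kern_def powr_diff)

lemma set_integrable_gamma:
  assumes "-1 < (a :: real)"
  shows "set_integrable lborel {0<..} (\<lambda>x. x powr a * exp (- x))"
proof -
  have "(\<integral>\<^sup>+ x. ennreal (norm (indicator {0<..} x *\<^sub>R (x powr a * exp (- x)))) \<partial>lborel)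
      \<le> (\<integral>\<^sup>+ x. ennreal (indicator {0..} x * x powr (a + 1 - 1) / exp x) \<partial>lborel)"
    by (rule nn_integral_mono)
       (auto simp: indicator_def exp_minus field_simps intro!: ennreal_leI)
  also have "\<dots> = ennreal (Gamma (a + 1))"
    using Gamma_conv_nn_integral_real[of "a + 1"] assms by simp
  also have "\<dots> < \<infinity>" by simp
  finally show ?thesis
    unfolding set_integrable_def by (intro integrableI_bounded) auto
qed

lemma power_le_fact_exp: "0 \<le> (y :: real) \<Longrightarrow> y ^ j \<le> fact j * exp y"
proof -
  assume y: "0 \<le> y"
  have "(\<Sum>n\<in>{j}. y ^ n /\<^sub>R fact n) \<le> exp y"
    unfolding exp_def by (rule sum_le_suminf) (use y summable_exp_generic[of y] in auto)
  then show ?thesis by (simp add: field_simps)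
qed

text \<open>For \<open>t > 0\<close> the factor \<open>exp (- t/x)\<close> beats any negative power of \<open>x\<close>: it is at most
  \<open>j! (x/t)\<^sup>j\<close>, and \<open>j\<close> is chosen to make the resulting Gamma integrand integrable.\<close>

lemma set_integrable_kern:
  assumes "0 < t \<or> (0 \<le> t \<and> -1 < a)"
  shows "set_integrable lborel {0<..} (kern t a)"
proof -
  obtain c b where cb: "-1 < b" "\<And>x. 0 < x \<Longrightarrow> kern t a x \<le> c * (x powr b * exp (- x))"
  proof (cases "0 < t")
    case False
    then have "t = 0" "-1 < a" using assms by auto
    then show ?thesis using that[of a 1] by (simp add: kern_def)
  next
    case True
    \<comment> \<open>The power of \<open>x\<close> has to exceed \<open>-1\<close> after adding \<open>j\<close>.\<close>
    define j where "j = nat \<lceil>\<bar>a\<bar>\<rceil>"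
    have j: "-1 < a + real j" unfolding j_def by linarith
    have "kern t a x \<le> fact j / t ^ j * (x powr (a + real j) * exp (- x))" if x: "0 < x" for x
    proof -
      have "(t / x) ^ j \<le> fact j * exp (t / x)" using True x by (intro power_le_fact_exp) simp
      then have "exp (- (t / x)) \<le> fact j / t ^ j * x ^ j"
        using True x by (simp add: exp_minus field_simps)
      then have "x powr a * exp (- x) * exp (- (t / x)) \<le> x powr a * exp (- x) * (fact j / t ^ j * x ^ j)"
        by (intro mult_left_mono) auto
      moreover have "kern t a x = x powr a * exp (- x) * exp (- (t / x))"
        unfolding kern_def mult.assoc exp_add[symmetric] by simp
      ultimately show ?thesis using x
        by (simp add: powr_add powr_realpow mult_ac)
    qed
    with j show ?thesis using that by blast
  qed
  show ?thesis
  proof (rule set_integrable_bound[OF _ _ AE_I2])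
    show "set_integrable lborel {0<..} (\<lambda>x. c * (x powr b * exp (- x)))"
      by (intro set_integrable_mult_right set_integrable_gamma cb)
    show "set_borel_measurable lborel {0<..} (kern t a)"
      unfolding set_borel_measurable_def by measurable
    show "x \<in> {0<..} \<longrightarrow> norm (kern t a x) \<le> norm (c * (x powr b * exp (- x)))" for x
      using cb(2)[of x] by auto
  qed
qed

lemma exp_taylor2: "\<bar>exp (- u) - 1 + u\<bar> \<le> u\<^sup>2 * exp \<bar>u\<bar>" for u :: real
proof -
  have le: "exp v - 1 \<le> v * exp v" for v :: real
  proof -
    have "(1 - v) * exp v \<le> exp (- v) * exp v"
      using exp_ge_add_one_self[of "- v"] by (intro mult_right_mono) auto
    then show ?thesis by (simp add: algebra_simps flip: exp_add)
  qed
  have "0 \<le> exp (- u) - 1 + u" using exp_ge_add_one_self[of "- u"] by simp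
  moreover have "exp (- u) - 1 + u \<le> u * (1 - exp (- u))" using le[of "- u"] by (simp add: algebra_simps)
  moreover have "u * (1 - exp (- u)) \<le> \<bar>u\<bar> * (\<bar>u\<bar> * exp \<bar>u\<bar>)"
  proof (cases "0 \<le> u")
    case True
    have "1 - exp (- u) \<le> u" using exp_ge_add_one_self[of "- u"] by simp
    also have "\<dots> \<le> u * exp u" using True by (simp add: mult_le_cancel_left1)
    finally show ?thesis using True by (simp add: mult_left_mono)
  next
    case False
    have "- u * (exp (- u) - 1) \<le> - u * (- u * exp (- u))"
      using le[of "- u"] False by (intro mult_left_mono) auto
    then show ?thesis using False by (simp add: algebra_simps)
  qed
  ultimately show ?thesis by (simp add: power2_eq_square mult.assoc)
qed

text \<open>The second order remainder of \<open>exp (- h/x)\<close> is at most \<open>(h/x)\<^sup>2 exp (t / (2x))\<close> when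
  \<open>\<bar>h\<bar> \<le> t/2\<close>, which only turns \<open>t\<close> into \<open>t/2\<close> in the integrand.\<close>

lemma bessel_int_derivative:
  assumes t: "0 < t"
  shows "((\<lambda>t. bessel_int t a) has_real_derivative - bessel_int t (a - 1)) (at t)"
proof -
  have bound: "\<bar>bessel_int (t + h) a - bessel_int t a + h * bessel_int t (a - 1)\<bar> \<le> h\<^sup>2 * bessel_int (t / 2) (a - 2)"
    if h: "\<bar>h\<bar> \<le> t / 2" for h :: real
  proof -
    have th: "0 < t + h" using h t by linarith
    have i: "set_integrable lborel {0<..} (kern (t + h) a)" "set_integrable lborel {0<..} (kern t a)"
      "set_integrable lborel {0<..} (kern t (a - 1))" "set_integrable lborel {0<..} (kern (t / 2) (a - 2))"
      by (rule set_integrable_kern, use t th in simp)+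
    note d = set_integral_diff[OF i(1,2)]
    have m: "set_integrable lborel {0<..} (\<lambda>x. h * kern t (a - 1) x)"
      using i(3) by (rule set_integrable_mult_right)
    note s = set_integral_add[OF d(1) m]
    have eq: "bessel_int (t + h) a - bessel_int t a + h * bessel_int t (a - 1)
      = (LINT x:{0<..}|lborel. kern (t + h) a x - kern t a x + h * kern t (a - 1) x)"
      unfolding s(2) d(2) set_integral_mult_right bessel_int_def ..
    have "\<bar>bessel_int (t + h) a - bessel_int t a + h * bessel_int t (a - 1)\<bar>
        \<le> (LINT x:{0<..}|lborel. \<bar>kern (t + h) a x - kern t a x + h * kern t (a - 1) x\<bar>)"
      using set_integral_norm_bound[OF s(1)] unfolding eq real_norm_def .
    also have "\<dots> \<le> (LINT x:{0<..}|lborel. h\<^sup>2 * kern (t / 2) (a - 2) x)"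
    proof (rule set_integral_mono)
      show "set_integrable lborel {0<..} (\<lambda>x. \<bar>kern (t + h) a x - kern t a x + h * kern t (a - 1) x\<bar>)"
        using s(1) by (rule set_integrable_abs)
      show "set_integrable lborel {0<..} (\<lambda>x. h\<^sup>2 * kern (t / 2) (a - 2) x)"
        using i(4) by (rule set_integrable_mult_right)
      fix x :: real assume "x \<in> {0<..}"
      then have x: "0 < x" by simp
      have e: "kern (t + h) a x - kern t a x + h * kern t (a - 1) x
          = kern t a x * (exp (- (h / x)) - 1 + h / x)"
      proof -
        have "kern (t + h) a x = kern t a x * exp (- (h / x))"
          unfolding kern_def mult.assoc exp_add[symmetric] by (simp add: add_divide_distrib)
        then show ?thesis using x by (simp add: kern_minus_one algebra_simps)
      qed
      have "\<bar>kern t a x * (exp (- (h / x)) - 1 + h / x)\<bar> \<le> kern t a x * ((h / x)\<^sup>2 * exp \<bar>h / x\<bar>)"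
        using exp_taylor2[of "h / x"] by (auto simp: abs_mult intro!: mult_left_mono)
      also have "\<dots> \<le> kern t a x * ((h / x)\<^sup>2 * exp ((t / 2) / x))"
        using h x by (intro mult_left_mono) (auto simp: field_simps)
      also have "\<dots> = h\<^sup>2 * kern (t / 2) (a - 2) x"
      proof -
        have "x powr (a - 2) = x powr a / x\<^sup>2" using x by (simp add: powr_diff)
        moreover have "exp (- x - t / x) * exp ((t / 2) / x) = exp (- x - (t / 2) / x)"
          unfolding exp_add[symmetric] by (rule arg_cong[where f = exp]) (use x in \<open>simp add: field_simps\<close>)
        ultimately show ?thesis
          by (simp add: kern_def power_divide)
      qed
      finally show "\<bar>kern (t + h) a x - kern t a x + h * kern t (a - 1) x\<bar> \<le> h\<^sup>2 * kern (t / 2) (a - 2) x"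
        unfolding e .
    qed
    also have "\<dots> = h\<^sup>2 * bessel_int (t / 2) (a - 2)" by (simp add: bessel_int_def)
    finally show ?thesis .
  qed
  have "(\<lambda>h. (bessel_int (t + h) a - bessel_int t a) / h) \<midarrow>0\<rightarrow> - bessel_int t (a - 1)"
  proof (rule LIM_zero_cancel, rule Lim_null_comparison)
    show "\<forall>\<^sub>F h in at 0. norm ((bessel_int (t + h) a - bessel_int t a) / h - - bessel_int t (a - 1)) \<le> \<bar>h\<bar> * bessel_int (t / 2) (a - 2)"
      unfolding eventually_at
    proof (intro exI[of _ "t / 2"] conjI ballI impI)
      fix h :: real assume h: "h \<noteq> 0 \<and> dist h 0 < t / 2"
      then have "\<bar>bessel_int (t + h) a - bessel_int t a + h * bessel_int t (a - 1)\<bar> / \<bar>h\<bar> \<le> h\<^sup>2 * bessel_int (t / 2) (a - 2) / \<bar>h\<bar>"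
        by (intro divide_right_mono bound) auto
      also have "\<dots> = \<bar>h\<bar> * bessel_int (t / 2) (a - 2)"
        using h by (cases "h > 0") (auto simp: power2_eq_square)
      also have "\<bar>bessel_int (t + h) a - bessel_int t a + h * bessel_int t (a - 1)\<bar> / \<bar>h\<bar>
         = \<bar>(bessel_int (t + h) a - bessel_int t a) / h - - bessel_int t (a - 1)\<bar>"
        using h by (simp add: abs_divide[symmetric] add_divide_distrib del: abs_divide)
      finally show "norm ((bessel_int (t + h) a - bessel_int t a) / h - - bessel_int t (a - 1)) \<le> \<bar>h\<bar> * bessel_int (t / 2) (a - 2)"
        by simp
    qed (use t in auto)
    show "((\<lambda>h. \<bar>h\<bar> * bessel_int (t / 2) (a - 2)) \<longlongrightarrow> 0) (at 0)"
      by (auto intro!: tendsto_eq_intros)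
  qed
  then show ?thesis unfolding DERIV_def .
qed

lemma bessel_int_near_0:
  assumes "0 < a" "0 \<le> t"
  shows "\<bar>bessel_int t a - bessel_int 0 a\<bar> \<le> t * bessel_int 0 (a - 1)"
proof -
  have i: "set_integrable lborel {0<..} (kern t a)" "set_integrable lborel {0<..} (kern 0 a)"
      "set_integrable lborel {0<..} (kern 0 (a - 1))"
    by (rule set_integrable_kern, use assms in auto)+
  note d = set_integral_diff[OF i(1,2)]
  have "\<bar>bessel_int t a - bessel_int 0 a\<bar> = \<bar>LINT x:{0<..}|lborel. kern t a x - kern 0 a x\<bar>"
    unfolding d(2) bessel_int_def ..
  also have "\<dots> \<le> (LINT x:{0<..}|lborel. \<bar>kern t a x - kern 0 a x\<bar>)"
    using set_integral_norm_bound[OF d(1)] by simp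
  also have "\<dots> \<le> (LINT x:{0<..}|lborel. t * kern 0 (a - 1) x)"
  proof (rule set_integral_mono)
    show "set_integrable lborel {0<..} (\<lambda>x. \<bar>kern t a x - kern 0 a x\<bar>)"
      using d(1) by (rule set_integrable_abs)
    show "set_integrable lborel {0<..} (\<lambda>x. t * kern 0 (a - 1) x)"
      using i(3) by (rule set_integrable_mult_right)
    fix x :: real assume "x \<in> {0<..}"
    then have x: "0 < x" by simp
    have e: "kern t a x - kern 0 a x = kern 0 a x * (exp (- (t / x)) - 1)"
      by (simp add: kern_def exp_diff exp_minus field_simps)
    have "\<bar>exp (- (t / x)) - 1\<bar> \<le> t / x"
      using exp_ge_add_one_self[of "- (t / x)"] assms x by (auto simp: abs_le_iff)
    then have "\<bar>kern t a x - kern 0 a x\<bar> \<le> kern 0 a x * (t / x)"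
      unfolding e abs_mult abs_of_nonneg[OF kern_nonneg] by (rule mult_left_mono) simp
    then show "\<bar>kern t a x - kern 0 a x\<bar> \<le> t * kern 0 (a - 1) x"
      using x by (simp add: kern_minus_one mult.commute)
  qed
  finally show ?thesis by (simp add: bessel_int_def)
qed

lemma bessel_int_rec:
  assumes t: "0 < t"
  shows "bessel_int t a = a * bessel_int t (a - 1) + t * bessel_int t (a - 2)"
proof -
  define f where "f = (\<lambda>x. a * kern t (a - 1) x - kern t a x + t * kern t (a - 2) x)"
  have i: "set_integrable lborel {0<..} (kern t b)" for b
    by (rule set_integrable_kern) (use t in simp)
  have ein: "einterval 0 \<infinity> = {0::real<..}"
    by (auto simp: einterval_def zero_ereal_def)
  have "(LBINT x=0..\<infinity>. f x) = 0 - 0"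
  proof (rule interval_integral_FTC_integrable[where F = "kern t a"])
    show "(kern t a has_vector_derivative f x) (at x)" if "0 < ereal x" for x
    proof -
      have x: "0 < x" using that by (simp add: zero_ereal_def)
      have "(kern t a has_real_derivative a * x powr (a - 1) * exp (- x - t / x)
          + exp (- x - t / x) * (- 1 + t / x\<^sup>2) * x powr a) (at x)"
        unfolding kern_def using x
        by (auto intro!: derivative_eq_intros simp: powr_diff field_simps power2_eq_square)
      moreover have "a * x powr (a - 1) * exp (- x - t / x)
          + exp (- x - t / x) * (- 1 + t / x\<^sup>2) * x powr a = f x"
        using x by (simp add: f_def kern_def powr_diff field_simps)
      ultimately show ?thesis by (simp add: has_real_derivative_iff_has_vector_derivative)
    qed
    show "isCont f x" if "0 < ereal x" for x
      using that unfolding f_def kern_def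
      by (intro continuous_intros) (auto simp: zero_ereal_def)
    show "set_integrable lborel (einterval 0 \<infinity>) f"
      unfolding ein f_def using i by (intro set_integral_add set_integral_diff set_integrable_mult_right) auto
    have lim_inf: "((\<lambda>x. kern t a x) \<longlongrightarrow> 0) at_top"
    proof (rule tendsto_sandwich[OF always_eventually _ tendsto_const])
      show "\<forall>\<^sub>F x in at_top. kern t a x \<le> x powr a * exp (- x)"
        using eventually_gt_at_top[of 0] by eventually_elim (use t in \<open>auto simp: kern_def intro!: mult_left_mono\<close>)
      show "((\<lambda>x. x powr a * exp (- x)) \<longlongrightarrow> 0) at_top" by real_asymp
    qed simp
    show "((kern t a \<circ> real_of_ereal) \<longlongrightarrow> 0) (at_left \<infinity>)"
      unfolding ereal_tendsto_simps1 ereal_tendsto_simps2 using lim_inf by simp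
    have lim_0: "((\<lambda>x. kern t a x) \<longlongrightarrow> 0) (at_right 0)"
    proof (rule tendsto_sandwich[OF always_eventually _ tendsto_const])
      show "\<forall>\<^sub>F x in at_right 0. kern t a x \<le> x powr a * exp (- t / x)"
        using eventually_at_right_less[of 0] by eventually_elim (use t in \<open>auto simp: kern_def intro!: mult_left_mono\<close>)
      show "((\<lambda>x. x powr a * exp (- t / x)) \<longlongrightarrow> 0) (at_right 0)" using t by real_asymp
    qed simp
    show "((kern t a \<circ> real_of_ereal) \<longlongrightarrow> 0) (at_right 0)"
      unfolding zero_ereal_def ereal_tendsto_simps1 using lim_0 by simp
  qed simp
  then have "(LINT x:{0<..}|lborel. f x) = 0"
    by (simp add: interval_lebesgue_integral_def ein)
  moreover have "(LINT x:{0<..}|lborel. f x) = a * bessel_int t (a - 1) - bessel_int t a + t * bessel_int t (a - 2)"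
    unfolding f_def bessel_int_def using i by (simp add: set_integral_add set_integral_diff)
  ultimately show ?thesis by simp
qed

definition lmom :: "real \<Rightarrow> real \<Rightarrow> int \<Rightarrow> real" where
  "lmom \<alpha> t k = bessel_int t (of_int k + \<alpha>)"

lemma mfun_lmom:
  assumes "0 < t \<or> (0 \<le> t \<and> -1 < of_int j + \<alpha>)"
  shows "set_integrable lborel {0<..} (\<lambda>x. poly p x * kern t (of_int j + \<alpha>) x)" (is ?A)
    and "mfun (lmom \<alpha> t) j p = (LINT x:{0<..}|lborel. poly p x * kern t (of_int j + \<alpha>) x)" (is ?B)
proof -
  let ?f = "\<lambda>x. \<Sum>i\<le>degree p. coeff p i * kern t (of_int (int i + j) + \<alpha>) x"
  have i: "set_integrable lborel {0<..} (kern t (of_int (int i + j) + \<alpha>))" for i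
    by (rule set_integrable_kern) (use assms in auto)
  have e: "poly p x * kern t (of_int j + \<alpha>) x = ?f x" if "x \<in> {0<..}" for x
  proof -
    have "poly p x * kern t (of_int j + \<alpha>) x = (\<Sum>i\<le>degree p. coeff p i * (x ^ i * kern t (of_int j + \<alpha>) x))"
      by (simp add: poly_altdef sum_distrib_right mult.assoc)
    also have "\<dots> = ?f x"
      using that by (intro sum.cong refl) (simp add: kern_shift algebra_simps)
    finally show ?thesis .
  qed
  have ci: "set_integrable lborel {0<..} (\<lambda>x. coeff p i * kern t (of_int (int i + j) + \<alpha>) x)" for i
    using i by (rule set_integrable_mult_right)
  have fi: "set_integrable lborel {0<..} ?f" and fs: "(LINT x:{0<..}|lborel. ?f x)
      = (\<Sum>i\<le>degree p. LINT x:{0<..}|lborel. coeff p i * kern t (of_int (int i + j) + \<alpha>) x)"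
    using ci unfolding set_integrable_def set_lebesgue_integral_def scaleR_sum_right
    by (intro Bochner_Integration.integrable_sum Bochner_Integration.integral_sum; simp only:)+
  then show ?A
    using e by (subst set_integrable_cong[OF refl refl]) (auto)
  have "mfun (lmom \<alpha> t) j p = (LINT x:{0<..}|lborel. ?f x)"
    unfolding fs set_integral_mult_right by (simp add: mfun_def lmom_def bessel_int_def)
  also have "\<dots> = (LINT x:{0<..}|lborel. poly p x * kern t (of_int j + \<alpha>) x)"
    by (rule set_lebesgue_integral_cong) (use e in auto)
  finally show ?B .
qed

lemma mfun_lmom_pos:
  assumes "0 < t \<or> (0 \<le> t \<and> -1 < of_int j + \<alpha>)" and "p \<noteq> 0"
  shows "0 < mfun (lmom \<alpha> t) j (p * p)"
proof -
  let ?f = "\<lambda>x. indicator {0<..} x *\<^sub>R (poly (p * p) x * kern t (of_int j + \<alpha>) x) :: real"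
  have eq: "mfun (lmom \<alpha> t) j (p * p) = integral\<^sup>L lborel ?f"
    using mfun_lmom(2)[OF assms(1)] by (simp add: set_lebesgue_integral_def)
  have int: "integrable lborel ?f"
    using mfun_lmom(1)[OF assms(1), of "p * p"] unfolding set_integrable_def .
  have nn: "0 \<le> ?f x" for x by (auto simp: indicator_def)
  have "integral\<^sup>L lborel ?f \<noteq> 0"
  proof
    assume "integral\<^sup>L lborel ?f = 0"
    then have "AE x in lborel. ?f x = 0"
      using integral_nonneg_eq_0_iff_AE[OF int] nn by simp
    moreover have "AE x in lborel. x \<notin> {x. poly p x = 0}"
      by (intro AE_not_in finite_imp_null_set_lborel poly_roots_finite assms)
    ultimately have "AE x in lborel. x \<notin> {0::real<..}"
    proof eventually_elim
      case (elim x)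
      then show ?case using kern_pos[of x t "of_int j + \<alpha>"] by (auto simp: indicator_def)
    qed
    then have "emeasure lborel {0::real<..} = 0"
      by (subst (asm) AE_iff_measurable[of "{0<..}"]) auto
    moreover have "emeasure lborel {0::real<..1} \<le> emeasure lborel {0::real<..}"
      by (rule emeasure_mono) auto
    ultimately show False by simp
  qed
  moreover have "0 \<le> integral\<^sup>L lborel ?f" using nn by (rule Bochner_Integration.integral_nonneg)
  ultimately show ?thesis unfolding eq by linarith
qed

lemma positive_moments_lmom: "0 < \<alpha> \<Longrightarrow> 0 \<le> t \<Longrightarrow> positive_moments (lmom \<alpha> t)"
  by unfold_locales (rule mfun_lmom_pos, auto)

lemma laguerre_moments_lmom: "0 < \<alpha> \<Longrightarrow> 0 < t \<Longrightarrow> laguerre_moments (lmom \<alpha> t) \<alpha> t"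
proof (unfold_locales, goal_cases)
  case (1 p j) then show ?case by (intro mfun_lmom_pos) auto
next
  case (2 k) then show ?case using bessel_int_rec[of t "of_int k + \<alpha>"] by (simp add: lmom_def algebra_simps)
qed auto

section \<open>Evolution in time\<close>

text \<open>The coefficients are built from finitely many moments by field operations; the predicate
  \<open>Q\<close> stands for either continuity or differentiability in the parameter.\<close>

lemma opoly_coeff_closed:
  fixes Q :: "(real \<Rightarrow> real) \<Rightarrow> bool" and m :: "real \<Rightarrow> int \<Rightarrow> real"
  assumes const: "\<And>c. Q (\<lambda>_. c)"
    and add: "\<And>f g. Q f \<Longrightarrow> Q g \<Longrightarrow> Q (\<lambda>s. f s + g s)"
    and mult: "\<And>f g. Q f \<Longrightarrow> Q g \<Longrightarrow> Q (\<lambda>s. f s * g s)"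
    and divide: "\<And>f g. Q f \<Longrightarrow> Q g \<Longrightarrow> (\<And>s. s \<in> S \<Longrightarrow> g s \<noteq> 0) \<Longrightarrow> Q (\<lambda>s. f s / g s)"
    and moments: "\<And>k. 0 \<le> k \<Longrightarrow> Q (\<lambda>s. m s k)"
    and pos: "\<And>s. s \<in> S \<Longrightarrow> positive_moments (m s)"
  shows "Q (\<lambda>s. coeff (opoly (m s) n) i)" "Q (\<lambda>s. hnorm (m s) n)"
proof -
  have sum: "Q (\<lambda>s. \<Sum>k\<in>K. f k s)" if "\<And>k. k \<in> K \<Longrightarrow> Q (f k)" for f and K :: "nat set"
    using that by (induction K rule: infinite_finite_induct) (auto intro!: const add)
  have sq: "Q (\<lambda>s. mfun (m s) j (opoly (m s) n * opoly (m s) n))"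
    if "0 \<le> j" "\<And>i. Q (\<lambda>s. coeff (opoly (m s) n) i)" for j n
  proof -
    have "mfun (m s) j (opoly (m s) n * opoly (m s) n)
        = (\<Sum>i\<le>n + n. (\<Sum>k\<le>i. coeff (opoly (m s) n) k * coeff (opoly (m s) n) (i - k)) * m s (int i + j))" for s
      by (subst mfun_bound[of _ "n + n"])
         (auto simp: coeff_mult intro: order.trans[OF degree_mult_le])
    then show ?thesis using that by (auto intro!: sum mult moments)
  qed
  have *: "\<forall>i. Q (\<lambda>s. coeff (opoly (m s) n) i)" for n
  proof (induction n rule: less_induct)
    case (less n)
    show ?case
    proof (cases n)
      case 0
      then show ?thesis by (auto intro: const)
    next
      case (Suc k)
      have c: "Q (\<lambda>s. coeff (opoly (m s) k) i)" "Q (\<lambda>s. coeff (opoly (m s) (k - 1)) i)" for i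
        using less.IH[of k] less.IH[of "k - 1"] Suc by auto
      have h: "hnorm (m s) j \<noteq> 0" if "s \<in> S" for s j
        using positive_moments.hnorm_pos[OF pos[OF that], of j] by simp
      have a: "Q (\<lambda>s. arec (m s) k)" unfolding arec_def
        by (intro divide h) (auto simp: hnorm_def intro!: sq c)
      have b: "Q (\<lambda>s. brec (m s) k)"
      proof (cases "k = 0")
        case False
        then show ?thesis unfolding brec_def
          by (simp, intro divide h) (auto simp: hnorm_def intro!: sq c c(2)[simplified])
      qed (auto simp: brec_def intro: const)
      have e: "coeff (opoly (m s) n) i = coeff ([:0,1:] * opoly (m s) k) i
          + (- 1) * (arec (m s) k * coeff (opoly (m s) k) i)
          + (- 1) * (brec (m s) k * coeff (opoly (m s) (k - 1)) i)" for s i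
        unfolding opoly_rec Suc by simp
      have x: "Q (\<lambda>s. coeff ([:0,1:] * opoly (m s) k) i)" for i
        using c by (cases i) (auto intro: const)
      show ?thesis unfolding e
        by (intro allI add mult const a b c x)
    qed
  qed
  then show "Q (\<lambda>s. coeff (opoly (m s) n) i)" by blast
  show "Q (\<lambda>s. hnorm (m s) n)" unfolding hnorm_def using * by (intro sq) auto
qed

lemma lmom_derivative:
  "0 < t \<Longrightarrow> ((\<lambda>s. lmom \<alpha> s k) has_real_derivative - lmom \<alpha> t (k - 1)) (at t)"
  using bessel_int_derivative[of t "of_int k + \<alpha>"] by (simp add: lmom_def algebra_simps)

lemma lmom_differentiable: "0 < t \<Longrightarrow> (\<lambda>s. lmom \<alpha> s k) differentiable (at t)"
  using lmom_derivative real_differentiable_def by blast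

lemma lmom_continuous_on:
  assumes "0 < \<alpha>" "0 \<le> k"
  shows "continuous_on {0..} (\<lambda>s. lmom \<alpha> s k)"
  unfolding continuous_on_eq_continuous_within
proof
  fix t :: real assume "t \<in> {0..}"
  show "continuous (at t within {0..}) (\<lambda>s. lmom \<alpha> s k)"
  proof (cases "t = 0")
    case False
    then have "isCont (\<lambda>s. lmom \<alpha> s k) t"
      using \<open>t \<in> {0..}\<close> by (intro DERIV_isCont[OF lmom_derivative]) auto
    then show ?thesis by (rule continuous_at_imp_continuous_at_within)
  next
    case True
    have "((\<lambda>s. lmom \<alpha> s k - lmom \<alpha> 0 k) \<longlongrightarrow> 0) (at 0 within {0..})"
    proof (rule Lim_null_comparison)
      show "\<forall>\<^sub>F s in at 0 within {0..}. norm (lmom \<alpha> s k - lmom \<alpha> 0 k) \<le> s * bessel_int 0 (of_int k + \<alpha> - 1)"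
        unfolding eventually_at_filter lmom_def
        using assms by (intro always_eventually) (auto intro!: bessel_int_near_0)
      show "((\<lambda>s. s * bessel_int 0 (of_int k + \<alpha> - 1)) \<longlongrightarrow> 0) (at 0 within {0..})"
        by (auto intro!: tendsto_eq_intros)
    qed
    then show ?thesis unfolding True continuous_within by (rule LIM_zero_cancel)
  qed
qed

lemma hnorm_lmom_continuous_on:
  assumes "0 < \<alpha>"
  shows "continuous_on {0..} (\<lambda>s. hnorm (lmom \<alpha> s) n)"
  by (rule opoly_coeff_closed(2)[where S = "{0..}"])
     (use assms in \<open>auto intro!: continuous_intros lmom_continuous_on positive_moments_lmom\<close>)

lemma opoly_lmom_differentiable:
  assumes "0 < \<alpha>" "0 < t"
  shows "(\<lambda>s. coeff (opoly (lmom \<alpha> s) n) i) differentiable (at t)"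
  by (rule opoly_coeff_closed(1)[where S = "{t}"])
     (use assms in \<open>auto intro!: differentiable_add differentiable_mult differentiable_divide positive_moments_lmom
        lmom_differentiable\<close>)

text \<open>Coefficientwise differentiability. The uniform bound on the degree turns the moment
  functional into a sum of fixed length.\<close>

definition poly_deriv_at :: "(real \<Rightarrow> real poly) \<Rightarrow> real poly \<Rightarrow> real \<Rightarrow> bool" where
  "poly_deriv_at p p' t \<longleftrightarrow> (\<exists>N. \<forall>s. degree (p s) \<le> N) \<and>
     (\<forall>i. ((\<lambda>s. coeff (p s) i) has_real_derivative coeff p' i) (at t))"

lemma poly_deriv_at_mult:
  assumes "poly_deriv_at p p' t" "poly_deriv_at q q' t"
  shows "poly_deriv_at (\<lambda>s. p s * q s) (p' * q t + p t * q') t"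
proof -
  obtain N M where NM: "\<And>s. degree (p s) \<le> N" "\<And>s. degree (q s) \<le> M"
    using assms unfolding poly_deriv_at_def by blast
  have "\<forall>s. degree (p s * q s) \<le> N + M"
    using NM by (meson add_mono degree_mult_le order_trans)
  moreover have "((\<lambda>s. coeff (p s * q s) i) has_real_derivative coeff (p' * q t + p t * q') i) (at t)" for i
  proof -
    have "((\<lambda>s. \<Sum>k\<le>i. coeff (p s) k * coeff (q s) (i - k)) has_real_derivative
       (\<Sum>k\<le>i. coeff p' k * coeff (q t) (i - k) + coeff q' (i - k) * coeff (p t) k)) (at t)"
      using assms unfolding poly_deriv_at_def by (intro DERIV_sum DERIV_mult) auto
    also have "(\<Sum>k\<le>i. coeff p' k * coeff (q t) (i - k) + coeff q' (i - k) * coeff (p t) k)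
      = coeff (p' * q t + p t * q') i"
      by (simp add: coeff_mult sum.distrib mult.commute[of "coeff (p t) _"])
    finally show ?thesis by (simp add: coeff_mult)
  qed
  ultimately show ?thesis unfolding poly_deriv_at_def by blast
qed

lemma mfun_derivative:
  assumes t: "0 < t" and p: "poly_deriv_at p p' t"
  shows "((\<lambda>s. mfun (lmom \<alpha> s) j (p s)) has_real_derivative
     mfun (lmom \<alpha> t) j p' - mfun (lmom \<alpha> t) (j - 1) (p t)) (at t)"
proof -
  obtain N where N: "\<And>s. degree (p s) \<le> N" using p unfolding poly_deriv_at_def by blast
  define K where "K = max N (degree p')"
  have K: "degree (p s) \<le> K" "degree p' \<le> K" for s using N[of s] by (auto simp: K_def)
  have "((\<lambda>s. \<Sum>i\<le>K. coeff (p s) i * lmom \<alpha> s (int i + j)) has_real_derivative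
     (\<Sum>i\<le>K. coeff p' i * lmom \<alpha> t (int i + j) + - lmom \<alpha> t (int i + j - 1) * coeff (p t) i)) (at t)"
    using p unfolding poly_deriv_at_def by (intro DERIV_sum DERIV_mult lmom_derivative t) auto
  then show ?thesis using K
    by (simp add: mfun_bound[of _ K] sum.distrib sum_negf algebra_simps sum_subtractf)
qed

lemma opoly_lmom_poly_deriv:
  assumes "0 < \<alpha>" "0 < t"
  obtains p' where "poly_deriv_at (\<lambda>s. opoly (lmom \<alpha> s) n) p' t" "degree p' < n \<or> p' = 0"
proof -
  define d where "d i = deriv (\<lambda>s. coeff (opoly (lmom \<alpha> s) n) i) t" for i
  have d: "((\<lambda>s. coeff (opoly (lmom \<alpha> s) n) i) has_real_derivative d i) (at t)" for i
    using opoly_lmom_differentiable[OF assms, of n i]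
    by (simp add: d_def DERIV_deriv_iff_real_differentiable)
  define p' where "p' = (\<Sum>i<n. Polynomial.monom (d i) i)"
  have c: "coeff p' i = (if i < n then d i else 0)" for i
    by (simp add: p'_def coeff_sum)
  have z: "d i = 0" if "n \<le> i" for i
  proof -
    have "(\<lambda>s. coeff (opoly (lmom \<alpha> s) n) i) = (\<lambda>s. if i = n then 1 else 0)"
      using that by (auto simp: coeff_eq_0)
    then show ?thesis by (simp add: d_def)
  qed
  have "coeff p' i = d i" for i using c[of i] z[of i] by auto
  then have "poly_deriv_at (\<lambda>s. opoly (lmom \<alpha> s) n) p' t"
    unfolding poly_deriv_at_def using d by auto
  moreover have "degree p' < n \<or> p' = 0"
    using c by (metis leading_coeff_0_iff)
  ultimately show ?thesis using that by blast
qed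

text \<open>The derivative of \<open>P\<^sub>n\<close> has lower degree, as \<open>P\<^sub>n\<close> stays monic, and is therefore
  orthogonal to \<open>P\<^sub>n\<close>: only the weight contributes.\<close>

lemma hnorm_derivative:
  assumes "0 < \<alpha>" "0 < t"
  shows "((\<lambda>s. hnorm (lmom \<alpha> s) n) has_real_derivative
    - inv_mean (lmom \<alpha> t) n * hnorm (lmom \<alpha> t) n) (at t)"
proof -
  interpret laguerre_moments "lmom \<alpha> t" \<alpha> t by (rule laguerre_moments_lmom[OF assms])
  obtain p' where p': "poly_deriv_at (\<lambda>s. opoly (lmom \<alpha> s) n) p' t" "degree p' < n \<or> p' = 0"
    using opoly_lmom_poly_deriv[OF assms] .
  have 0: "mfun (lmom \<alpha> t) 0 (Pn n * p') = 0" using p'(2) by (rule opoly_pairing_less)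
  show ?thesis
    using mfun_derivative[OF assms(2) poly_deriv_at_mult[OF p'(1) p'(1)], of \<alpha> 0] 0 hnorm_pos[of n]
    by (simp add: hnorm_def inv_mean_def mfun_add mfun_smult numeral_mult_poly mult.commute[of p'])
qed

text \<open>Differentiate \<open>\<langle>P\<^sub>n, P\<^sub>n\<^sub>-\<^sub>1\<rangle> = 0\<close>: the derivative of \<open>P\<^sub>n\<close> pairs with \<open>P\<^sub>n\<^sub>-\<^sub>1\<close> to its leading
  coefficient times \<open>h\<^sub>n\<^sub>-\<^sub>1\<close>, and the derivative of \<open>P\<^sub>n\<^sub>-\<^sub>1\<close> drops out.\<close>

lemma subleading_derivative:
  assumes "0 < \<alpha>" "0 < t" "0 < n"
  shows "((\<lambda>s. coeff (opoly (lmom \<alpha> s) n) (n - 1)) has_real_derivative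
    inv_cross (lmom \<alpha> t) t n / t) (at t)"
proof -
  interpret laguerre_moments "lmom \<alpha> t" \<alpha> t by (rule laguerre_moments_lmom[OF assms(1,2)])
  obtain p' where p': "poly_deriv_at (\<lambda>s. opoly (lmom \<alpha> s) n) p' t" "degree p' < n \<or> p' = 0"
    using opoly_lmom_poly_deriv[OF assms(1,2)] .
  obtain q' where q': "poly_deriv_at (\<lambda>s. opoly (lmom \<alpha> s) (n - 1)) q' t" "degree q' < n - 1 \<or> q' = 0"
    using opoly_lmom_poly_deriv[OF assms(1,2)] .
  have "degree q' < n \<or> q' = 0" using q'(2) by auto
  then have 0: "mfun (lmom \<alpha> t) 0 (Pn n * q') = 0" by (rule opoly_pairing_less)
  have "degree p' \<le> n - 1" using p'(2) by auto
  then have 1: "mfun (lmom \<alpha> t) 0 (p' * Pn (n - 1)) = coeff p' (n - 1) * hn (n - 1)"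
    using opoly_pairing[of p' "n - 1"] by (simp add: mult.commute)
  have d: "((\<lambda>s. mfun (lmom \<alpha> s) 0 (opoly (lmom \<alpha> s) n * opoly (lmom \<alpha> s) (n - 1))) has_real_derivative
     coeff p' (n - 1) * hn (n - 1) - mfun (lmom \<alpha> t) (-1) (Pn n * Pn (n - 1))) (at t)"
    using mfun_derivative[OF assms(2) poly_deriv_at_mult[OF p'(1) q'(1)], of \<alpha> 0] 0 1
    by (simp add: mfun_add)
  have "((\<lambda>s. mfun (lmom \<alpha> s) 0 (opoly (lmom \<alpha> s) n * opoly (lmom \<alpha> s) (n - 1))) has_real_derivative 0) (at t)"
  proof (rule DERIV_cong_ev[THEN iffD2, OF refl _ refl DERIV_const])
    show "\<forall>\<^sub>F s in nhds t. mfun (lmom \<alpha> s) 0 (opoly (lmom \<alpha> s) n * opoly (lmom \<alpha> s) (n - 1)) = 0"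
      using eventually_nhds_in_open[of "{0<..}" t] assms
      by (auto elim!: eventually_mono intro!: positive_moments.opoly_orth positive_moments_lmom)
  qed
  from DERIV_unique[OF d this] have "coeff p' (n - 1) = inv_cross (lmom \<alpha> t) t n / t"
    using hnorm_pos[of "n - 1"] assms(2) by (simp add: inv_cross_def field_simps)
  then show ?thesis using p'(1) unfolding poly_deriv_at_def by metis
qed

text \<open>The first equation differentiates \<open>t C\<^sub>n = p\<^sub>n - p\<^sub>n\<^sub>+\<^sub>1 - N\<close> and removes \<open>r\<^sub>n\<^sub>+\<^sub>1\<close> by
  \<open>rvar_Suc\<close>; the second differentiates \<open>r\<^sub>n = \<beta>\<^sub>n + p\<^sub>n\<close> and removes \<open>\<beta>\<^sub>n R\<^sub>n\<close> and
  \<open>\<beta>\<^sub>n R\<^sub>n\<^sub>-\<^sub>1\<close> by \<open>rvar_quadratic\<close>, leaving a system for the single index \<open>n\<close>.\<close>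

lemma inv_mean_derivative:
  assumes "0 < \<alpha>" "0 < t" "0 < n"
  defines "R \<equiv> t * inv_mean (lmom \<alpha> t) n" and "r \<equiv> inv_cross (lmom \<alpha> t) t n"
    and "N \<equiv> 2 * real n + 1 + \<alpha>"
  shows "((\<lambda>s. s * inv_mean (lmom \<alpha> s) n) has_real_derivative (2 * r - t + N * R + R\<^sup>2) / t) (at t)"
    and "((\<lambda>s. inv_cross (lmom \<alpha> s) s n) has_real_derivative
      (r + 2 * (r\<^sup>2 - t * r) / R - real n * t + (2 * real n + \<alpha>) * r) / t) (at t)"
proof -
  interpret laguerre_moments "lmom \<alpha> t" \<alpha> t by (rule laguerre_moments_lmom[OF assms(1,2)])
  let ?p = "\<lambda>k s. coeff (opoly (lmom \<alpha> s) k) (k - 1)"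
  have R: "0 < R" using assms cpot_pos[of n] by (simp add: R_def)
  have ev: "\<forall>\<^sub>F s in nhds t. 0 < s" using eventually_nhds_in_open[of "{0<..}" t] assms by auto
  have "((\<lambda>s. ?p n s - ?p (Suc n) s - N) has_real_derivative r / t - inv_cross (lmom \<alpha> t) t (Suc n) / t - 0) (at t)"
    unfolding r_def using assms by (intro DERIV_diff subleading_derivative DERIV_const) auto
  moreover have "\<forall>\<^sub>F s in nhds t. s * inv_mean (lmom \<alpha> s) n = ?p n s - ?p (Suc n) s - N"
    using ev
  proof eventually_elim
    case (elim s)
    interpret s: laguerre_moments "lmom \<alpha> s" \<alpha> s by (rule laguerre_moments_lmom[OF assms(1) elim])
    show ?case using s.p1_diff[OF assms(3)] s.arec_eq[of n] by (simp add: N_def)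
  qed
  moreover have eq: "r / t - inv_cross (lmom \<alpha> t) t (Suc n) / t - 0 = (2 * r - t + N * R + R\<^sup>2) / t"
    using rvar_Suc[OF assms(3)] arec_eq[of n] assms(2)
    by (simp add: field_simps power2_eq_square r_def R_def N_def)
  ultimately show "((\<lambda>s. s * inv_mean (lmom \<alpha> s) n) has_real_derivative (2 * r - t + N * R + R\<^sup>2) / t) (at t)"
    unfolding eq by (subst DERIV_cong_ev[OF refl _ refl])
  have dh: "((\<lambda>s. hnorm (lmom \<alpha> s) k) has_real_derivative - cpot k * hn k) (at t)" for k
    by (rule hnorm_derivative[OF assms(1,2)])
  have "((\<lambda>s. hnorm (lmom \<alpha> s) n / hnorm (lmom \<alpha> s) (n - 1) + ?p n s) has_real_derivative
    ((- cpot n * hn n) * hn (n - 1) - hn n * (- cpot (n - 1) * hn (n - 1))) / (hn (n - 1) * hn (n - 1)) + r / t) (at t)"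
    unfolding r_def using assms hnorm_pos[of "n - 1"]
    by (intro DERIV_add DERIV_divide subleading_derivative dh) auto
  moreover have "\<forall>\<^sub>F s in nhds t. inv_cross (lmom \<alpha> s) s n = hnorm (lmom \<alpha> s) n / hnorm (lmom \<alpha> s) (n - 1) + ?p n s"
    using ev
  proof eventually_elim
    case (elim s)
    interpret s: laguerre_moments "lmom \<alpha> s" \<alpha> s by (rule laguerre_moments_lmom[OF assms(1) elim])
    show ?case using s.brec_eq[OF assms(3)] assms(3) by (simp add: brec_def)
  qed
  moreover have eq': "((- cpot n * hn n) * hn (n - 1) - hn n * (- cpot (n - 1) * hn (n - 1))) / (hn (n - 1) * hn (n - 1)) + r / t
     = (r + 2 * (r\<^sup>2 - t * r) / R - real n * t + (2 * real n + \<alpha>) * r) / t"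
  proof -
    define b where "b = brec (lmom \<alpha> t) n"
    define c where "c = t * cpot (n - 1)"
    have "((- cpot n * hn n) * hn (n - 1) - hn n * (- cpot (n - 1) * hn (n - 1))) / (hn (n - 1) * hn (n - 1)) + r / t
       = (b * (c - R) + r) / t"
      using hnorm_pos[of "n - 1"] assms by (simp add: b_def c_def R_def brec_def field_simps)
    also have "b * (c - R) + r = r + 2 * (r\<^sup>2 - t * r) / R - real n * t + (2 * real n + \<alpha>) * r"
    proof -
      have "(r\<^sup>2 - t * r) / R = b * c"
      proof -
        have "r\<^sup>2 - t * r = b * c * R"
          using rvar_quadratic(1)[OF assms(3)] by (simp add: b_def c_def R_def r_def mult_ac)
        then show ?thesis using R by simp
      qed
      then have "2 * (r\<^sup>2 - t * r) / R = 2 * (b * c)"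
        by (metis times_divide_eq_right)
      moreover have "real n * (r - t) + (real n + \<alpha>) * r + b * (R + c) = 0"
        using rvar_quadratic(2)[OF assms(3)] by (simp add: b_def c_def R_def r_def)
      ultimately show ?thesis by (simp add: algebra_simps)
    qed
    finally show ?thesis .
  qed
  ultimately show "((\<lambda>s. inv_cross (lmom \<alpha> s) s n) has_real_derivative
      (r + 2 * (r\<^sup>2 - t * r) / R - real n * t + (2 * real n + \<alpha>) * r) / t) (at t)"
    unfolding eq' by (subst DERIV_cong_ev[OF refl _ refl])
qed

section \<open>Maximum principle and convergence of the Painleve solutions\<close>

text \<open>The comparison function on the right solves \<open>f'' = a\<^sup>2 f - \<rho>\<close> and dominates \<open>w\<close> at the end
  points. A positive maximum of the difference would be interior and have a positive second
  derivative.\<close>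

lemma interval_max_principle:
  fixes w w' w'' :: "real \<Rightarrow> real"
  assumes a: "0 < a" and T: "0 < T" and \<rho>: "0 \<le> \<rho>" and B: "0 \<le> B"
    and d1: "\<And>x. (w has_real_derivative w' x) (at x)"
    and d2: "\<And>x. (w' has_real_derivative w'' x) (at x)"
    and ineq: "\<And>x. \<bar>x\<bar> \<le> T \<Longrightarrow> 0 < w x \<Longrightarrow> a\<^sup>2 * w x - \<rho> \<le> w'' x"
    and ends: "w (- T) \<le> B" "w T \<le> B" and x: "\<bar>x\<bar> \<le> T"
  shows "w x \<le> \<rho> / a\<^sup>2 + B * cosh (a * x) / cosh (a * T)"
proof (rule ccontr)
  assume neg: "\<not> ?thesis"
  define k where "k = B / cosh (a * T)"
  have k: "0 \<le> k" using B by (simp add: k_def)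
  define g where "g y = w y - \<rho> / a\<^sup>2 - k * cosh (a * y)" for y
  define g' where "g' y = w' y - k * (a * sinh (a * y))" for y
  have dg: "(g has_real_derivative g' y) (at y)" for y
    unfolding g_def g'_def by (auto intro!: derivative_eq_intros d1)
  have dg': "(g' has_real_derivative w'' y - k * (a\<^sup>2 * cosh (a * y))) (at y)" for y
    unfolding g'_def by (auto intro!: derivative_eq_intros d2 simp: power2_eq_square)
  have "continuous_on {-T..T} g"
    using dg by (meson DERIV_isCont continuous_at_imp_continuous_on)
  then obtain z where z: "z \<in> {-T..T}" "\<And>y. y \<in> {-T..T} \<Longrightarrow> g y \<le> g z"
    using continuous_attains_sup[of "{-T..T}" g] T by auto
  have "0 < g x" using neg by (simp add: g_def k_def)
  moreover have "g x \<le> g z" using z(2)[of x] x by (simp add: abs_le_iff)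
  ultimately have gz: "0 < g z" by simp
  have "g T \<le> 0" "g (- T) \<le> 0"
  proof -
    have "0 \<le> \<rho> / a\<^sup>2" using \<rho> by simp
    then show "g T \<le> 0" "g (- T) \<le> 0" using ends by (auto simp: g_def k_def)
  qed
  then have zT: "z \<in> {-T<..<T}" using gz z(1) by (cases "z = T"; cases "z = - T") auto
  define d where "d = min (T - z) (T + z)"
  have d: "0 < d" "\<And>y. \<bar>y - z\<bar> < d \<Longrightarrow> y \<in> {-T..T}" using zT by (auto simp: d_def)
  have g'0: "g' z = 0"
    by (rule DERIV_local_max[OF dg, of d]) (use d z(2) in \<open>auto simp: abs_minus_commute\<close>)
  have kc: "0 \<le> k * cosh (a * z)" using k by simp
  have wz: "0 < w z" using gz kc \<rho> a by (simp add: g_def) (smt (verit) divide_nonneg_nonneg zero_le_power2)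
  have "0 < a\<^sup>2 * g z" using gz a by simp
  also have "a\<^sup>2 * g z = a\<^sup>2 * w z - \<rho> - k * (a\<^sup>2 * cosh (a * z))"
    using a by (simp add: g_def field_simps)
  also have "\<dots> \<le> w'' z - k * (a\<^sup>2 * cosh (a * z))"
    using ineq[of z] wz z(1) by (auto simp: abs_le_iff)
  finally have "0 < w'' z - k * (a\<^sup>2 * cosh (a * z))" .
  from DERIV_pos_inc_right[OF dg' this] obtain e
    where e: "0 < e" "\<And>h. 0 < h \<Longrightarrow> h < e \<Longrightarrow> g' z < g' (z + h)" by blast
  define h where "h = min d e / 2"
  have h: "0 < h" "h < d" "h < e" using d e by (auto simp: h_def)
  obtain y where y: "z < y" "y < z + h" "g (z + h) - g z = (z + h - z) * g' y"
    using MVT2[of z "z + h" g g'] dg h by auto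
  have "0 < g' y" using e(2)[of "y - z"] y h g'0 by auto
  then have "0 < h * g' y" using h(1) by simp
  then have "g z < g (z + h)" using y(3) by simp
  moreover have "g (z + h) \<le> g z" using z(2) d(2)[of "z + h"] h by auto
  ultimately show False by simp
qed

text \<open>For \<open>\<kappa> = 0\<close>, \<open>C = exp u\<close> and \<open>s = exp \<tau>\<close>, the equation \<open>u'' = painleve_rhs \<alpha> \<kappa> \<tau> u\<close> is
  \<open>C'' = C'\<^sup>2 / C - C' / s + C\<^sup>2 / s + \<alpha> / s\<^sup>2 - 1 / (s\<^sup>2 C)\<close>, a Painleve III equation in \<open>s\<close>.\<close>

definition painleve_rhs :: "real \<Rightarrow> real \<Rightarrow> real \<Rightarrow> real \<Rightarrow> real" where
  "painleve_rhs \<alpha> \<kappa> \<tau> u = exp (\<tau> + u) + \<kappa> * exp (2 * \<tau> + 2 * u) + \<alpha> * exp (- u) - exp (- 2 * u)"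

text \<open>Only \<open>\<alpha> exp (- u) - exp (- 2 u)\<close> can fail to increase; its derivative is
  \<open>exp (- u) (2 exp (- u) - \<alpha>)\<close>, and \<open>exp (- u) \<ge> \<alpha>\<close> in the given range.\<close>

lemma painleve_rhs_increasing:
  assumes \<alpha>: "0 < \<alpha>" and "0 \<le> \<kappa>" "v \<le> u" "u \<le> - ln \<alpha>"
  shows "\<alpha>\<^sup>2 * (u - v) \<le> painleve_rhs \<alpha> \<kappa> \<tau> u - painleve_rhs \<alpha> \<kappa> \<tau> v"
proof (cases "v = u")
  case False
  then have vu: "v < u" using assms by simp
  define \<psi> where "\<psi> z = \<alpha> * exp (- z) - exp (- 2 * z)" for z :: real
  have "(\<psi> has_real_derivative - \<alpha> * exp (- z) + 2 * exp (- 2 * z)) (at z)" for z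
    unfolding \<psi>_def by (auto intro!: derivative_eq_intros)
  then obtain z where z: "v < z" "z < u" "\<psi> u - \<psi> v = (u - v) * (- \<alpha> * exp (- z) + 2 * exp (- 2 * z))"
    using MVT2[OF vu, of \<psi> "\<lambda>z. - \<alpha> * exp (- z) + 2 * exp (- 2 * z)"] by blast
  have "ln \<alpha> \<le> - z" using z assms by simp
  then have "exp (ln \<alpha>) \<le> exp (- z)" by (subst exp_le_cancel_iff)
  then have ez: "\<alpha> \<le> exp (- z)" using exp_ln[OF \<alpha>] by simp
  have "- \<alpha> * exp (- z) + 2 * exp (- 2 * z) = exp (- z) * (2 * exp (- z) - \<alpha>)"
    by (simp add: algebra_simps flip: exp_add)
  also have "\<dots> \<ge> \<alpha> * \<alpha>" using ez \<alpha> by (intro mult_mono) auto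
  finally have "\<alpha>\<^sup>2 \<le> - \<alpha> * exp (- z) + 2 * exp (- 2 * z)" by (simp add: power2_eq_square)
  then have "\<alpha>\<^sup>2 * (u - v) \<le> \<psi> u - \<psi> v" using vu unfolding z(3) by (simp add: mult.commute)
  moreover have "\<kappa> * exp (2 * \<tau> + 2 * v) \<le> \<kappa> * exp (2 * \<tau> + 2 * u)"
    using assms by (intro mult_left_mono) auto
  moreover have "exp (\<tau> + v) \<le> exp (\<tau> + u)" using vu by simp
  ultimately show ?thesis unfolding painleve_rhs_def \<psi>_def by linarith
qed simp

lemma derivative_interpolation:
  fixes w w' w'' :: "real \<Rightarrow> real"
  assumes d1: "\<And>x. (w has_real_derivative w' x) (at x)"
    and d2: "\<And>x. (w' has_real_derivative w'' x) (at x)"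
    and h: "h \<noteq> 0" and M: "\<And>x. \<bar>x - y\<bar> \<le> \<bar>h\<bar> \<Longrightarrow> \<bar>w'' x\<bar> \<le> M"
  shows "\<bar>w (y + h) - w y - h * w' y\<bar> \<le> M * h\<^sup>2"
proof -
  have "\<exists>z. \<bar>z - y\<bar> \<le> \<bar>h\<bar> \<and> w (y + h) - w y = h * w' z"
  proof (cases "0 < h")
    case True
    then obtain z where "y < z" "z < y + h" "w (y + h) - w y = (y + h - y) * w' z"
      using MVT2[of y "y + h" w w'] d1 by auto
    then show ?thesis using True by (intro exI[of _ z]) auto
  next
    case False
    then obtain z where "y + h < z" "z < y" "w y - w (y + h) = (y - (y + h)) * w' z"
      using MVT2[of "y + h" y w w'] d1 h by auto
    then show ?thesis using False by (intro exI[of _ z]) (auto simp: algebra_simps)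
  qed
  then obtain z where z: "\<bar>z - y\<bar> \<le> \<bar>h\<bar>" "w (y + h) - w y = h * w' z" by blast
  have "norm (w' z - w' y) \<le> M * norm (z - y)"
  proof (rule field_differentiable_bound[of "{y - \<bar>h\<bar>..y + \<bar>h\<bar>}" w' w''])
    show "(w' has_field_derivative w'' x) (at x within {y - \<bar>h\<bar>..y + \<bar>h\<bar>})" for x
      using d2 by (rule has_field_derivative_at_within)
    show "norm (w'' x) \<le> M" if "x \<in> {y - \<bar>h\<bar>..y + \<bar>h\<bar>}" for x
      using M[of x] that by (auto simp: abs_le_iff)
  qed (use z in \<open>auto simp: abs_le_iff\<close>)
  also have "\<dots> \<le> M * \<bar>h\<bar>"
    using z M[of y] by (intro mult_left_mono) auto
  finally have "\<bar>h\<bar> * \<bar>w' z - w' y\<bar> \<le> \<bar>h\<bar> * (M * \<bar>h\<bar>)" by (intro mult_left_mono) auto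
  then show ?thesis unfolding z(2) by (simp add: power2_eq_square algebra_simps flip: abs_mult)
qed

text \<open>The crude lower bound is available only for \<open>exp \<tau> \<le> N\<close>, an interval that grows with \<open>n\<close>,
  and gets worse with \<open>n\<close> only logarithmically, which the damping in the maximum principle outweighs.\<close>

locale painleve_family =
  fixes \<alpha> :: real and u p :: "nat \<Rightarrow> real \<Rightarrow> real" and N :: "nat \<Rightarrow> real"
  assumes alpha_pos: "0 < \<alpha>"
    and N_def: "N n = 2 * real n + 1 + \<alpha>"
    and u_deriv: "0 < n \<Longrightarrow> (u n has_real_derivative p n \<tau>) (at \<tau>)"
    and p_deriv: "0 < n \<Longrightarrow> (p n has_real_derivative painleve_rhs \<alpha> (1 / (N n)\<^sup>2) \<tau> (u n \<tau>)) (at \<tau>)"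
    and u_upper: "0 < n \<Longrightarrow> u n \<tau> \<le> - ln \<alpha>"
    and u_lower: "0 < n \<Longrightarrow> \<tau> \<le> ln (N n) \<Longrightarrow> - ln (N n + 1 / \<alpha>) \<le> u n \<tau>"
begin

lemma N_gt_1: "1 < N n"
  using alpha_pos by (simp add: N_def)

text \<open>The logarithm of \<open>C = c / (1 + s)\<close> with \<open>c = 1 / (4 (1 + \<alpha>))\<close>. For so small a \<open>C\<close> the term
  \<open>- 1 / C\<^sup>2\<close> dominates the right-hand side of the equation, and \<open>sC\<close> stays bounded, so this is a
  subsolution on the whole line.\<close>

definition barrier :: "real \<Rightarrow> real" where
  "barrier \<tau> = - ln (4 * (1 + \<alpha>)) - ln (1 + exp \<tau>)"

lemma barrier_le: "barrier \<tau> \<le> - ln \<alpha>"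
proof -
  have "\<alpha> * 1 \<le> 4 * (1 + \<alpha>) * (1 + exp \<tau>)" using alpha_pos by (intro mult_mono) auto
  then have "ln \<alpha> \<le> ln (4 * (1 + \<alpha>) * (1 + exp \<tau>))" using alpha_pos by simp
  moreover have "ln (4 * (1 + \<alpha>) * (1 + exp \<tau>)) = ln (4 * (1 + \<alpha>)) + ln (1 + exp \<tau>)"
    using alpha_pos by (intro ln_mult_pos) (auto intro: add_pos_pos)
  ultimately show ?thesis by (simp add: barrier_def)
qed

lemma barrier_deriv:
  "(barrier has_real_derivative - (exp \<tau> / (1 + exp \<tau>))) (at \<tau>)"
  "((\<lambda>\<tau>. - (exp \<tau> / (1 + exp \<tau>))) has_real_derivative - (exp \<tau> / (1 + exp \<tau>)\<^sup>2)) (at \<tau>)"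
proof -
  have "1 + exp \<tau> \<noteq> 0" "0 < 1 + exp \<tau>" using exp_gt_zero[of \<tau>] by linarith+
  then show "(barrier has_real_derivative - (exp \<tau> / (1 + exp \<tau>))) (at \<tau>)"
    "((\<lambda>\<tau>. - (exp \<tau> / (1 + exp \<tau>))) has_real_derivative - (exp \<tau> / (1 + exp \<tau>)\<^sup>2)) (at \<tau>)"
    unfolding barrier_def
    by (auto intro!: derivative_eq_intros simp: field_simps power2_eq_square)
qed

lemma barrier_subsolution:
  assumes "0 \<le> \<kappa>" "\<kappa> \<le> 1"
  shows "painleve_rhs \<alpha> \<kappa> \<tau> (barrier \<tau>) \<le> - (exp \<tau> / (1 + exp \<tau>)\<^sup>2)"
proof -
  define s where "s = exp \<tau>"
  define c where "c = 1 / (4 * (1 + \<alpha>))"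
  define C where "C = c / (1 + s)"
  have s: "0 < s" by (simp add: s_def)
  have c: "0 < c" "c \<le> 1 / 4" "\<alpha> * c \<le> 1 / 4" using alpha_pos by (auto simp: c_def field_simps)
  have C: "0 < C" "C \<le> c" "s * C \<le> c" using s c by (auto simp: C_def field_simps)
  have eC: "exp (barrier \<tau>) = C"
    using alpha_pos s by (simp add: barrier_def C_def c_def exp_diff exp_minus s_def add_pos_pos field_simps)
  have "painleve_rhs \<alpha> \<kappa> \<tau> (barrier \<tau>) = s * C + \<kappa> * (s * C)\<^sup>2 + \<alpha> / C - 1 / C\<^sup>2"
  proof -
    have e1: "exp (\<tau> + barrier \<tau>) = s * C" "exp (- barrier \<tau>) = 1 / C"
      by (simp_all add: exp_add exp_minus eC s_def field_simps)
    have e2: "exp (2 * \<tau> + 2 * barrier \<tau>) = (s * C)\<^sup>2" "exp (- 2 * barrier \<tau>) = 1 / C\<^sup>2"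
      unfolding power_one_over[symmetric] e1[symmetric] by (simp_all add: power2_eq_square flip: exp_add)
    show ?thesis unfolding painleve_rhs_def e1 e2 by simp
  qed
  also have "\<dots> = (C\<^sup>2 * (s * C) + \<kappa> * (C\<^sup>2 * (s * C)\<^sup>2) + \<alpha> * C - 1) / C\<^sup>2"
    using C by (simp add: field_simps power2_eq_square)
  also have "\<dots> \<le> (- 1 / 4) / C\<^sup>2"
  proof (rule divide_right_mono)
    have C1: "C \<le> 1 / 4" "s * C \<le> 1 / 4" using C c by auto
    have a: "C\<^sup>2 \<le> 1" using C C1 by (simp add: power_le_one)
    have b: "(s * C)\<^sup>2 \<le> (1 / 4)\<^sup>2" using C C1 s by (intro power_mono) auto
    have "C\<^sup>2 * (s * C) \<le> 1 * (1 / 4)" using a C1 s C by (intro mult_mono) auto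
    moreover have "\<kappa> * (C\<^sup>2 * (s * C)\<^sup>2) \<le> 1 * (1 * (1 / 4)\<^sup>2)"
      using a b assms by (intro mult_mono) auto
    moreover have "\<alpha> * C \<le> 1 / 4" using mult_left_mono[OF C(2), of \<alpha>] alpha_pos c by linarith
    ultimately show "C\<^sup>2 * (s * C) + \<kappa> * (C\<^sup>2 * (s * C)\<^sup>2) + \<alpha> * C - 1 \<le> - 1 / 4"
      by (simp add: power2_eq_square)
  qed simp
  also have "\<dots> \<le> - 1"
  proof -
    have "C\<^sup>2 \<le> (1 / 4)\<^sup>2" using C c by (intro power_mono) auto
    then show ?thesis using C by (simp add: power2_eq_square field_simps)
  qed
  also have "\<dots> \<le> - (s / (1 + s)\<^sup>2)"
  proof -
    have "s \<le> (1 + s)\<^sup>2" using s by (simp add: power2_eq_square algebra_simps)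
    then show ?thesis using s by (simp add: divide_le_eq_1)
  qed
  finally show ?thesis by (simp add: s_def)
qed

text \<open>Maximum principle for \<open>barrier - u\<^sub>n\<close> on \<open>[- ln N, ln N]\<close>: the boundary values are of size \<open>ln N\<close>
  and are damped by \<open>1 / cosh (\<alpha> ln N) \<le> 2 N\<^bsup>-\<alpha>\<^esup>\<close>.\<close>

lemma eventually_above_barrier:
  "\<forall>\<^sub>F n in sequentially. \<forall>\<tau>. \<bar>\<tau>\<bar> \<le> T \<longrightarrow> barrier \<tau> - 1 \<le> u n \<tau>"
proof -
  have "((\<lambda>n. 2 * cosh (\<alpha> * T) * (ln (N n + 1 / \<alpha>) * N n powr (- \<alpha>))) \<longlongrightarrow> 2 * cosh (\<alpha> * T) * 0) sequentially"
    unfolding N_def using alpha_pos by (intro tendsto_mult tendsto_const) real_asymp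
  then have "\<forall>\<^sub>F n in sequentially. 2 * cosh (\<alpha> * T) * (ln (N n + 1 / \<alpha>) * N n powr (- \<alpha>)) < 1"
    by (rule order_tendstoD(2)) simp
  moreover have "\<forall>\<^sub>F n in sequentially. T \<le> ln (N n)"
    unfolding N_def using alpha_pos by real_asymp
  ultimately show ?thesis using eventually_gt_at_top[of 0]
  proof eventually_elim
    case (elim n)
    let ?B = "ln (N n + 1 / \<alpha>)"
    have B: "0 \<le> ?B" using N_gt_1[of n] alpha_pos by (simp add: add_increasing2)
    have \<kappa>: "0 \<le> 1 / (N n)\<^sup>2" "1 / (N n)\<^sup>2 \<le> 1" using N_gt_1[of n] by (auto simp: divide_le_eq_1 intro!: one_le_power)
    have L: "0 < ln (N n)" using N_gt_1[of n] by simp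
    have bb: "barrier \<tau> \<le> 0" for \<tau>
    proof -
      have "0 \<le> ln (4 * (1 + \<alpha>))" by (rule ln_ge_zero) (use alpha_pos in simp)
      moreover have "0 \<le> ln (1 + exp \<tau>)" by (rule ln_ge_zero) simp
      ultimately show ?thesis unfolding barrier_def by linarith
    qed
    show ?case
    proof (intro allI impI)
      fix \<tau> :: real assume \<tau>: "\<bar>\<tau>\<bar> \<le> T"
      have "barrier \<tau> - u n \<tau> \<le> 0 / \<alpha>\<^sup>2 + ?B * cosh (\<alpha> * \<tau>) / cosh (\<alpha> * ln (N n))"
      proof (rule interval_max_principle[where w = "\<lambda>\<tau>. barrier \<tau> - u n \<tau>"])
        show "((\<lambda>\<tau>. barrier \<tau> - u n \<tau>) has_real_derivative (- (exp x / (1 + exp x))) - p n x) (at x)" for x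
          by (intro DERIV_diff barrier_deriv u_deriv elim)
        show "((\<lambda>x. (- (exp x / (1 + exp x))) - p n x) has_real_derivative
            (- (exp x / (1 + exp x)\<^sup>2)) - painleve_rhs \<alpha> (1 / (N n)\<^sup>2) x (u n x)) (at x)" for x
          by (intro DERIV_diff barrier_deriv p_deriv elim)
        show "\<alpha>\<^sup>2 * (barrier x - u n x) - 0 \<le> (- (exp x / (1 + exp x)\<^sup>2)) - painleve_rhs \<alpha> (1 / (N n)\<^sup>2) x (u n x)"
          if "0 < barrier x - u n x" for x
          using barrier_subsolution[OF \<kappa>, of x]
            painleve_rhs_increasing[OF alpha_pos \<kappa>(1), of "u n x" "barrier x" x] barrier_le[of x] that by simp
        show "barrier (- ln (N n)) - u n (- ln (N n)) \<le> ?B" "barrier (ln (N n)) - u n (ln (N n)) \<le> ?B"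
          using u_lower[of n "- ln (N n)"] u_lower[of n "ln (N n)"] bb[of "- ln (N n)"] bb[of "ln (N n)"] L elim
          by auto
      qed (use alpha_pos L B \<tau> elim in auto)
      also have "0 / \<alpha>\<^sup>2 + ?B * cosh (\<alpha> * \<tau>) / cosh (\<alpha> * ln (N n)) \<le> ?B * cosh (\<alpha> * T) / (N n powr \<alpha> / 2)"
      proof -
        have "cosh (\<alpha> * \<tau>) = cosh (\<alpha> * \<bar>\<tau>\<bar>)" by (cases "0 \<le> \<tau>") auto
        also have "\<dots> \<le> cosh (\<alpha> * T)"
          using \<tau> alpha_pos by (subst cosh_real_nonneg_le_iff) (auto intro!: mult_left_mono)
        finally have 1: "cosh (\<alpha> * \<tau>) \<le> cosh (\<alpha> * T)" .
        have 2: "N n powr \<alpha> / 2 \<le> cosh (\<alpha> * ln (N n))"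
          using N_gt_1[of n] by (simp add: cosh_def powr_def)
        have "?B * cosh (\<alpha> * \<tau>) / cosh (\<alpha> * ln (N n)) \<le> ?B * cosh (\<alpha> * T) / (N n powr \<alpha> / 2)"
          using 1 2 B N_gt_1[of n] by (intro frac_le mult_left_mono mult_nonneg_nonneg) auto
        then show ?thesis by simp
      qed
      also have "\<dots> = 2 * cosh (\<alpha> * T) * (?B * N n powr (- \<alpha>))"
        by (simp add: powr_minus field_simps)
      also have "\<dots> < 1" by (rule elim)
      finally show "barrier \<tau> - 1 \<le> u n \<tau>" by simp
    qed
  qed
qed

definition lower_bound :: "real \<Rightarrow> real" where
  "lower_bound T = - ln (4 * (1 + \<alpha>)) - ln (1 + exp T) - 1"

lemma eventually_lower: "\<forall>\<^sub>F n in sequentially. \<forall>\<tau>. \<bar>\<tau>\<bar> \<le> T \<longrightarrow> lower_bound T \<le> u n \<tau>"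
  using eventually_above_barrier[of T]
proof eventually_elim
  case (elim n)
  show ?case
  proof (intro allI impI)
    fix \<tau> :: real assume "\<bar>\<tau>\<bar> \<le> T"
    then have "ln (1 + exp \<tau>) \<le> ln (1 + exp T)" by (simp add: add_pos_pos)
    then have "lower_bound T \<le> barrier \<tau> - 1" by (simp add: lower_bound_def barrier_def)
    then show "lower_bound T \<le> u n \<tau>" using elim \<open>\<bar>\<tau>\<bar> \<le> T\<close> by force
  qed
qed

text \<open>The boundary difference \<open>- ln \<alpha> - lower_bound T\<close> grows only linearly in \<open>T\<close>, so \<open>T\<close> is fixed
  first, to make its damped contribution small, and then the indices, to make the \<open>1/N\<^sup>2\<close> term of the
  equation small on \<open>[-T, T]\<close>.\<close>

lemma u_Cauchy: "Cauchy (\<lambda>n. u n \<tau>)"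
proof (rule metric_CauchyI)
  fix e :: real assume e: "0 < e"
  define K where "K = \<bar>\<tau>\<bar>"
  have "((\<lambda>T. cosh (\<alpha> * K) * ((- ln \<alpha> - lower_bound T) / cosh (\<alpha> * T)))
      \<longlongrightarrow> cosh (\<alpha> * K) * 0) at_top"
    unfolding lower_bound_def using alpha_pos by (intro tendsto_mult tendsto_const) real_asymp
  then have "\<forall>\<^sub>F T in at_top. cosh (\<alpha> * K) * ((- ln \<alpha> - lower_bound T) / cosh (\<alpha> * T)) < e / 2"
    by (rule order_tendstoD(2)) (use e in simp)
  from eventually_conj[OF this eventually_gt_at_top[of K]]
  obtain T where T: "cosh (\<alpha> * K) * ((- ln \<alpha> - lower_bound T) / cosh (\<alpha> * T)) < e / 2" "K < T"
    using eventually_happens'[OF trivial_limit_at_top_linorder] by blast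
  define \<rho> where "\<rho> n = 1 / (N n)\<^sup>2 * (exp (2 * T) / \<alpha>\<^sup>2)" for n
  have "((\<lambda>n. 1 / (N n)\<^sup>2 * (exp (2 * T) / \<alpha>\<^sup>2 / \<alpha>\<^sup>2)) \<longlongrightarrow> 0 * (exp (2 * T) / \<alpha>\<^sup>2 / \<alpha>\<^sup>2)) sequentially"
    unfolding N_def by (intro tendsto_mult tendsto_const) real_asymp
  then have "\<forall>\<^sub>F n in sequentially. 1 / (N n)\<^sup>2 * (exp (2 * T) / \<alpha>\<^sup>2 / \<alpha>\<^sup>2) < e / 2"
    by (rule order_tendstoD(2)) (use e in simp)
  then have "\<forall>\<^sub>F n in sequentially. \<rho> n / \<alpha>\<^sup>2 < e / 2"
    unfolding \<rho>_def times_divide_eq_right .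
  then have "\<forall>\<^sub>F n in sequentially. \<rho> n / \<alpha>\<^sup>2 < e / 2 \<and> 0 < n \<and> (\<forall>\<tau>. \<bar>\<tau>\<bar> \<le> T \<longrightarrow> lower_bound T \<le> u n \<tau>)"
    using eventually_lower[of T] eventually_gt_at_top[of 0] by eventually_elim auto
  then obtain n0 where n0: "\<And>n. n0 \<le> n \<Longrightarrow> \<rho> n / \<alpha>\<^sup>2 < e / 2 \<and> 0 < n \<and> (\<forall>\<tau>. \<bar>\<tau>\<bar> \<le> T \<longrightarrow> lower_bound T \<le> u n \<tau>)"
    unfolding eventually_sequentially by blast
  have T0: "0 < T" using T by (simp add: K_def)
  have one: "u n \<tau> - u m \<tau> < e" if "n0 \<le> m" "n0 \<le> n" for m n
  proof -
    have B: "0 \<le> - ln \<alpha> - lower_bound T"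
    proof -
      have "lower_bound T \<le> u m 0" using n0[OF that(1)] T0 by auto
      then show ?thesis using n0[OF that(1)] u_upper[of m 0] by simp
    qed
    have \<kappa>: "0 \<le> 1 / (N k)\<^sup>2" for k by simp
    have "u n \<tau> - u m \<tau> \<le> \<rho> m / \<alpha>\<^sup>2 + (- ln \<alpha> - lower_bound T) * cosh (\<alpha> * \<tau>) / cosh (\<alpha> * T)"
    proof (rule interval_max_principle[where w = "\<lambda>\<tau>. u n \<tau> - u m \<tau>"])
      show "((\<lambda>\<tau>. u n \<tau> - u m \<tau>) has_real_derivative p n x - p m x) (at x)" for x
        using n0 that by (intro DERIV_diff u_deriv) auto
      show "((\<lambda>\<tau>. p n \<tau> - p m \<tau>) has_real_derivative
          painleve_rhs \<alpha> (1 / (N n)\<^sup>2) x (u n x) - painleve_rhs \<alpha> (1 / (N m)\<^sup>2) x (u m x)) (at x)" for x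
        using n0 that by (intro DERIV_diff p_deriv) auto
      show "\<alpha>\<^sup>2 * (u n x - u m x) - \<rho> m \<le> painleve_rhs \<alpha> (1 / (N n)\<^sup>2) x (u n x) - painleve_rhs \<alpha> (1 / (N m)\<^sup>2) x (u m x)"
        if x: "\<bar>x\<bar> \<le> T" and w: "0 < u n x - u m x" for x
      proof -
        have 1: "\<alpha>\<^sup>2 * (u n x - u m x) \<le> painleve_rhs \<alpha> (1 / (N n)\<^sup>2) x (u n x) - painleve_rhs \<alpha> (1 / (N n)\<^sup>2) x (u m x)"
          using w n0[OF \<open>n0 \<le> n\<close>] by (intro painleve_rhs_increasing alpha_pos \<kappa> u_upper) auto
        have "exp (2 * x + 2 * u m x) \<le> exp (2 * T + 2 * (- ln \<alpha>))"
          using u_upper[of m x] n0[OF \<open>n0 \<le> m\<close>] x by (auto intro!: add_mono)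
        also have "\<dots> = exp (2 * T) / \<alpha>\<^sup>2"
          using alpha_pos by (simp add: exp_diff exp_double)
        finally have "1 / (N m)\<^sup>2 * exp (2 * x + 2 * u m x) \<le> \<rho> m"
          unfolding \<rho>_def by (intro mult_left_mono \<kappa>)
        moreover have "0 \<le> 1 / (N n)\<^sup>2 * exp (2 * x + 2 * u m x)" by simp
        ultimately have "- \<rho> m \<le> painleve_rhs \<alpha> (1 / (N n)\<^sup>2) x (u m x) - painleve_rhs \<alpha> (1 / (N m)\<^sup>2) x (u m x)"
          unfolding painleve_rhs_def by linarith
        with 1 show ?thesis by linarith
      qed
      show "u n (- T) - u m (- T) \<le> - ln \<alpha> - lower_bound T" "u n T - u m T \<le> - ln \<alpha> - lower_bound T"
        using u_upper[of n T] u_upper[of n "- T"] n0[OF that(1)] n0[OF that(2)] T0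
        by (auto intro!: diff_mono)
    qed (use alpha_pos T0 T B in \<open>auto simp: \<rho>_def K_def\<close>)
    also have "(- ln \<alpha> - lower_bound T) * cosh (\<alpha> * \<tau>) / cosh (\<alpha> * T) = cosh (\<alpha> * K) * ((- ln \<alpha> - lower_bound T) / cosh (\<alpha> * T))"
      by (cases "0 \<le> \<tau>") (auto simp: K_def)
    finally show ?thesis using T(1) conjunct1[OF n0[OF that(1)]] by linarith
  qed
  show "\<exists>M. \<forall>m\<ge>M. \<forall>n\<ge>M. dist (u m \<tau>) (u n \<tau>) < e"
    using one by (intro exI[of _ n0]) (auto simp: dist_real_def abs_less_iff)
qed

lemma eventually_painleve_rhs_bound:
  "\<exists>M\<ge>0. \<forall>\<^sub>F n in sequentially. \<forall>x. \<bar>x\<bar> \<le> T \<longrightarrow> \<bar>painleve_rhs \<alpha> (1 / (N n)\<^sup>2) x (u n x)\<bar> \<le> M"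
proof (intro exI conjI)
  let ?M = "exp (T - ln \<alpha>) + exp (2 * T - 2 * ln \<alpha>) + \<alpha> * exp (- lower_bound T) + exp (- 2 * lower_bound T)"
  show "0 \<le> ?M" using alpha_pos by simp
  show "\<forall>\<^sub>F n in sequentially. \<forall>x. \<bar>x\<bar> \<le> T \<longrightarrow> \<bar>painleve_rhs \<alpha> (1 / (N n)\<^sup>2) x (u n x)\<bar> \<le> ?M"
    using eventually_lower[of T] eventually_gt_at_top[of 0]
  proof eventually_elim
    case (elim n)
    show ?case
    proof (intro allI impI)
      fix x :: real assume x: "\<bar>x\<bar> \<le> T"
      have b: "lower_bound T \<le> u n x" "u n x \<le> - ln \<alpha>" using elim x u_upper by auto
      have \<kappa>: "1 / (N n)\<^sup>2 \<le> 1" using N_gt_1[of n] by (auto simp: divide_le_eq_1 intro!: one_le_power)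
      have 1: "exp (x + u n x) \<le> exp (T - ln \<alpha>)" using x b by auto
      have "1 / (N n)\<^sup>2 * exp (2 * x + 2 * u n x) \<le> 1 * exp (2 * T - 2 * ln \<alpha>)"
        using x b by (intro mult_mono \<kappa>) auto
      then have 2: "1 / (N n)\<^sup>2 * exp (2 * x + 2 * u n x) \<le> exp (2 * T - 2 * ln \<alpha>)" by simp
      have 3: "\<alpha> * exp (- u n x) \<le> \<alpha> * exp (- lower_bound T)" using b alpha_pos by simp
      have 4: "exp (- 2 * u n x) \<le> exp (- 2 * lower_bound T)" using b by simp
      have "0 \<le> exp (x + u n x)" "0 \<le> 1 / (N n)\<^sup>2 * exp (2 * x + 2 * u n x)"
        "0 \<le> \<alpha> * exp (- u n x)" "0 \<le> exp (- 2 * u n x)" using alpha_pos by auto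
      with 1 2 3 4 show "\<bar>painleve_rhs \<alpha> (1 / (N n)\<^sup>2) x (u n x)\<bar> \<le> ?M"
        unfolding painleve_rhs_def abs_le_iff by linarith
    qed
  qed
qed

text \<open>A local bound \<open>M\<close> on \<open>u\<^sub>n''\<close> gives \<open>u\<^sub>n(\<tau> + h) = u\<^sub>n(\<tau>) + h p\<^sub>n(\<tau>) + O(M h\<^sup>2)\<close> uniformly in \<open>n\<close>. So the
  slopes \<open>p\<^sub>n(\<tau>)\<close> are within \<open>M h\<close> of a convergent sequence for every small \<open>h\<close>, and the expansion
  passes to the limit, where it says that the limit is differentiable.\<close>

theorem convergence:
  "\<exists>v q. \<forall>\<tau>. (\<lambda>n. u n \<tau>) \<longlonglongrightarrow> v \<tau> \<and> (\<lambda>n. p n \<tau>) \<longlonglongrightarrow> q \<tau> \<and> (v has_real_derivative q \<tau>) (at \<tau>)"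
proof -
  define v where "v \<tau> = lim (\<lambda>n. u n \<tau>)" for \<tau>
  have v: "(\<lambda>n. u n \<tau>) \<longlonglongrightarrow> v \<tau>" for \<tau>
    unfolding v_def using u_Cauchy[of \<tau>] by (simp add: Cauchy_convergent_iff convergent_LIMSEQ_iff)
  have taylor: "\<exists>M\<ge>0. \<forall>h. h \<noteq> 0 \<longrightarrow> \<bar>h\<bar> \<le> 1 \<longrightarrow>
     (\<forall>\<^sub>F n in sequentially. \<bar>u n (\<tau> + h) - u n \<tau> - h * p n \<tau>\<bar> \<le> M * h\<^sup>2)" for \<tau>
  proof -
    obtain M where M: "0 \<le> M" "\<forall>\<^sub>F n in sequentially. \<forall>x. \<bar>x\<bar> \<le> \<bar>\<tau>\<bar> + 1 \<longrightarrow> \<bar>painleve_rhs \<alpha> (1 / (N n)\<^sup>2) x (u n x)\<bar> \<le> M"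
      using eventually_painleve_rhs_bound by blast
    have "\<forall>\<^sub>F n in sequentially. \<bar>u n (\<tau> + h) - u n \<tau> - h * p n \<tau>\<bar> \<le> M * h\<^sup>2" if h: "h \<noteq> 0" "\<bar>h\<bar> \<le> 1" for h
      using M(2) eventually_gt_at_top[of 0]
    proof eventually_elim
      case (elim n)
      show ?case
        by (rule derivative_interpolation[OF u_deriv p_deriv h(1)]) (use elim h in auto)
    qed
    then show ?thesis using M(1) by blast
  qed
  have "convergent (\<lambda>n. p n \<tau>)" for \<tau>
  proof -
    obtain M where M: "0 \<le> M" "\<And>h. h \<noteq> 0 \<Longrightarrow> \<bar>h\<bar> \<le> 1 \<Longrightarrow>
       \<forall>\<^sub>F n in sequentially. \<bar>u n (\<tau> + h) - u n \<tau> - h * p n \<tau>\<bar> \<le> M * h\<^sup>2"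
      using taylor by blast
    have "Cauchy (\<lambda>n. p n \<tau>)"
    proof (rule metric_CauchyI)
      fix e :: real assume e: "0 < e"
      define h where "h = min 1 (e / (4 * (M + 1)))"
      have h: "0 < h" "h \<le> 1" "M * h < e / 2"
      proof -
        show "0 < h" "h \<le> 1" using e M by (auto simp: h_def)
        have "M * h \<le> M * (e / (4 * (M + 1)))" using M by (intro mult_left_mono) (auto simp: h_def)
        also have "\<dots> < e / 2" using e M by (simp add: field_simps add_pos_nonneg)
        finally show "M * h < e / 2" .
      qed
      define D where "D n = (u n (\<tau> + h) - u n \<tau>) / h" for n
      define \<delta> where "\<delta> = e / 2 - M * h"
      have \<delta>: "0 < \<delta>" using h by (simp add: \<delta>_def)
      have Dl: "D \<longlonglongrightarrow> (v (\<tau> + h) - v \<tau>) / h" unfolding D_def using h by (intro tendsto_intros v) auto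
      have "\<forall>\<^sub>F n in sequentially. \<bar>D n - (v (\<tau> + h) - v \<tau>) / h\<bar> < \<delta>"
        using tendstoD[OF Dl \<delta>] by (simp add: dist_real_def)
      moreover have "\<forall>\<^sub>F n in sequentially. \<bar>D n - p n \<tau>\<bar> \<le> M * h"
      proof -
        have "\<bar>D n - p n \<tau>\<bar> \<le> M * h" if "\<bar>u n (\<tau> + h) - u n \<tau> - h * p n \<tau>\<bar> \<le> M * h\<^sup>2" for n
        proof -
          have "D n - p n \<tau> = (u n (\<tau> + h) - u n \<tau> - h * p n \<tau>) / h"
            using h by (simp add: D_def field_simps)
          then have "\<bar>D n - p n \<tau>\<bar> = \<bar>u n (\<tau> + h) - u n \<tau> - h * p n \<tau>\<bar> / h" using h by simp
          also have "\<dots> \<le> M * h\<^sup>2 / h" using that h by (intro divide_right_mono) auto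
          finally show ?thesis using h by (simp add: power2_eq_square)
        qed
        then show ?thesis using M(2)[of h] h by (auto elim!: eventually_mono)
      qed
      ultimately have "\<forall>\<^sub>F n in sequentially. \<bar>p n \<tau> - (v (\<tau> + h) - v \<tau>) / h\<bar> < e / 2"
      proof eventually_elim
        case (elim n)
        then show ?case unfolding \<delta>_def by linarith
      qed
      then obtain n0 where near: "\<And>n. n0 \<le> n \<Longrightarrow> \<bar>p n \<tau> - (v (\<tau> + h) - v \<tau>) / h\<bar> < e / 2"
        unfolding eventually_sequentially by blast
      then show "\<exists>M. \<forall>m\<ge>M. \<forall>n\<ge>M. dist (p m \<tau>) (p n \<tau>) < e"
      proof (intro exI[of _ n0] allI impI)
        fix m n assume "n0 \<le> m" "n0 \<le> n"
        then show "dist (p m \<tau>) (p n \<tau>) < e" unfolding dist_real_def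
          using near[of m] near[of n] by linarith
      qed
    qed
    then show ?thesis by (simp add: Cauchy_convergent_iff)
  qed
  then have q: "(\<lambda>n. p n \<tau>) \<longlonglongrightarrow> lim (\<lambda>n. p n \<tau>)" for \<tau>
    by (simp add: convergent_LIMSEQ_iff)
  define q where "q \<tau> = lim (\<lambda>n. p n \<tau>)" for \<tau>
  have "(v has_real_derivative q \<tau>) (at \<tau>)" for \<tau>
  proof -
    obtain M where M: "0 \<le> M" "\<And>h. h \<noteq> 0 \<Longrightarrow> \<bar>h\<bar> \<le> 1 \<Longrightarrow>
       \<forall>\<^sub>F n in sequentially. \<bar>u n (\<tau> + h) - u n \<tau> - h * p n \<tau>\<bar> \<le> M * h\<^sup>2"
      using taylor by blast
    have b: "\<bar>v (\<tau> + h) - v \<tau> - h * q \<tau>\<bar> \<le> M * h\<^sup>2" if "h \<noteq> 0" "\<bar>h\<bar> \<le> 1" for h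
      by (rule tendsto_upperbound[OF _ M(2)[OF that]])
         (auto intro!: tendsto_intros v q[folded q_def])
    have "(\<lambda>h. (v (\<tau> + h) - v \<tau>) / h) \<midarrow>0\<rightarrow> q \<tau>"
    proof (rule LIM_zero_cancel, rule Lim_null_comparison)
      show "\<forall>\<^sub>F h in at 0. norm ((v (\<tau> + h) - v \<tau>) / h - q \<tau>) \<le> M * \<bar>h\<bar>"
        unfolding eventually_at
      proof (intro exI[of _ 1] conjI ballI impI)
        fix h :: real assume h: "h \<noteq> 0 \<and> dist h 0 < 1"
        have "(v (\<tau> + h) - v \<tau>) / h - q \<tau> = (v (\<tau> + h) - v \<tau> - h * q \<tau>) / h"
          using h by (simp add: field_simps)
        then have "norm ((v (\<tau> + h) - v \<tau>) / h - q \<tau>) = \<bar>v (\<tau> + h) - v \<tau> - h * q \<tau>\<bar> / \<bar>h\<bar>" by simp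
        also have "\<dots> \<le> M * h\<^sup>2 / \<bar>h\<bar>" using b[of h] h by (intro divide_right_mono) auto
        also have "\<dots> = M * \<bar>h\<bar>" using h by (cases "0 < h") (auto simp: power2_eq_square)
        finally show "norm ((v (\<tau> + h) - v \<tau>) / h - q \<tau>) \<le> M * \<bar>h\<bar>" .
      qed simp
      show "((\<lambda>h. M * \<bar>h\<bar>) \<longlongrightarrow> 0) (at 0)" by (auto intro!: tendsto_eq_intros)
    qed
    then show ?thesis unfolding DERIV_def .
  qed
  with v q show ?thesis unfolding q_def[symmetric] by blast
qed

end

section \<open>The double-scaled Hankel determinant\<close>

lemma weight_eq_kern: "weight t \<alpha> x = kern t \<alpha> x"
  by (simp add: weight_def kern_def)

lemma hankel_det_eq_prod:
  assumes "0 < \<alpha>" "0 \<le> t"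
  shows "hankel_det n t \<alpha> = (\<Prod>j<n. hnorm (lmom \<alpha> t) j)"
proof -
  have "(LINT x:{0<..}|lborel. x ^ k * weight t \<alpha> x) = lmom \<alpha> t (int k)" for k
    unfolding lmom_def bessel_int_def
    by (rule set_lebesgue_integral_cong) (auto simp: weight_eq_kern kern_shift add.commute)
  then have "hankel_det n t \<alpha> = Determinant.det (mat n n (\<lambda>(j, k). lmom \<alpha> t (int (j + k))))"
    unfolding hankel_det_def by simp
  then show ?thesis
    using positive_moments.det_hankel[OF positive_moments_lmom[OF assms]] by simp
qed

lemma orth_poly_eq_opoly:
  assumes "0 < \<alpha>" "0 \<le> t"
  shows "orth_poly t \<alpha> = opoly (lmom \<alpha> t)"
proof -
  interpret positive_moments "lmom \<alpha> t" by (rule positive_moments_lmom[OF assms])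
  have "(LINT x:{0<..}|lborel. poly p x * poly q x * weight t \<alpha> x) = mfun (lmom \<alpha> t) 0 (p * q)" for p q
    using mfun_lmom(2)[of t 0 \<alpha> "p * q"] assms by (simp add: weight_eq_kern)
  then have *: "monic_orthogonal t \<alpha> P \<longleftrightarrow>
      (\<forall>n. degree (P n) = n \<and> lead_coeff (P n) = 1) \<and>
      (\<forall>m n. m \<noteq> n \<longrightarrow> mfun (lmom \<alpha> t) 0 (P m * P n) = 0)" for P
    unfolding monic_orthogonal_def by simp
  show ?thesis unfolding orth_poly_def
  proof (rule the_equality)
    show "monic_orthogonal t \<alpha> (opoly (lmom \<alpha> t))" unfolding * by (auto intro: opoly_orth)
    show "P = opoly (lmom \<alpha> t)" if "monic_orthogonal t \<alpha> P" for P
      using that unfolding * by (intro opoly_unique) (auto, metis)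
  qed
qed

lemma rec_alpha_eq_arec:
  assumes "0 < \<alpha>" "0 \<le> t"
  shows "rec_alpha t \<alpha> = arec (lmom \<alpha> t)"
  unfolding rec_alpha_def orth_poly_eq_opoly[OF assms]
proof (rule the_equality)
  let ?P = "opoly (lmom \<alpha> t)"
  have "three_term_recurrence ?P (arec (lmom \<alpha> t)) (brec (lmom \<alpha> t))"
    unfolding three_term_recurrence_def opoly_rec by (simp add: brec_def)
  then show "\<exists>b. three_term_recurrence ?P (arec (lmom \<alpha> t)) b" by blast
  fix a assume "\<exists>b. three_term_recurrence ?P a b"
  then obtain b where b: "three_term_recurrence ?P a b" by blast
  show "a = arec (lmom \<alpha> t)"
  proof
    fix n
    have 1: "coeff ([:0, 1:] * ?P n) n = coeff (?P (Suc n)) n + a n"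
    proof -
      have e: "[:0, 1:] * ?P n = ?P (Suc n) + Polynomial.smult (a n) (?P n)
          + (if n = 0 then 0 else Polynomial.smult (b n) (?P (n - 1)))"
        using b unfolding three_term_recurrence_def by blast
      show ?thesis unfolding e by (auto simp: coeff_eq_0)
    qed
    have 2: "coeff ([:0, 1:] * ?P n) n = coeff (?P (Suc n)) n + arec (lmom \<alpha> t) n"
      unfolding opoly_rec by (cases n) (auto simp: coeff_eq_0 brec_def)
    show "a n = arec (lmom \<alpha> t) n" using 1 2 by simp
  qed
qed

lemma C_seq_eq_inv_mean:
  assumes "0 < \<alpha>" "0 < s"
  shows "C_seq \<alpha> s n = inv_mean (lmom \<alpha> (scaled_time \<alpha> n s)) n"
proof -
  define t where "t = scaled_time \<alpha> n s"
  have t: "0 < t" using assms by (simp add: t_def scaled_time_def add_pos_pos)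
  interpret laguerre_moments "lmom \<alpha> t" \<alpha> t by (rule laguerre_moments_lmom[OF assms(1) t])
  show ?thesis unfolding C_seq_def y_aux_def t_def[symmetric]
    using t assms by (simp add: rec_alpha_eq_arec arec_eq)
qed

text \<open>The elimination of \<open>r\<close>: the left-hand side is the quotient rule for \<open>D / R\<close>, the logarithmic
  derivative of \<open>R\<close>, when \<open>t\<close>, \<open>R\<close>, \<open>r\<close> have derivatives \<open>t\<close>, \<open>D\<close>, \<open>E\<close> with respect to \<open>ln t\<close>.\<close>

lemma painleve_rhs_identity:
  fixes R r t c N \<alpha> :: real
  assumes "R \<noteq> 0" and "N = 2 * c + 1 + \<alpha>"
  defines "D \<equiv> 2 * r - t + N * R + R\<^sup>2"
    and "E \<equiv> r + 2 * (r\<^sup>2 - t * r) / R - c * t + (2 * c + \<alpha>) * r"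
  shows "((2 * E - t + N * D + 2 * R * D) * R - (2 * r - t + N * R + R\<^sup>2) * D) / (R * R)
    = N * R + R\<^sup>2 + \<alpha> * (t / R) - (t / R)\<^sup>2"
proof -
  define e where "e = (r\<^sup>2 - t * r) / R"
  have "R * e = r\<^sup>2 - t * r" using assms by (simp add: e_def)
  have E: "E = r + 2 * e - c * t + (2 * c + \<alpha>) * r" by (simp add: E_def e_def)
  have "(2 * E - t + N * D + 2 * R * D) * R - (2 * r - t + N * R + R\<^sup>2) * D
     = 2 * r * R + 4 * (R * e) - 2 * c * t * R + 2 * (2 * c + \<alpha>) * r * R - t * R
        + D * (N * R + 2 * R\<^sup>2 - (2 * r - t + N * R + R\<^sup>2))"
    unfolding E by (simp add: algebra_simps power2_eq_square)
  also have "\<dots> = N * R * (R * R) + R\<^sup>2 * (R * R) + \<alpha> * t * R - t\<^sup>2"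
    unfolding \<open>R * e = _\<close> D_def assms(2) by (simp add: algebra_simps power2_eq_square)
  finally have eq: "(2 * E - t + N * D + 2 * R * D) * R - (2 * r - t + N * R + R\<^sup>2) * D
     = N * R * (R * R) + R\<^sup>2 * (R * R) + \<alpha> * t * R - t\<^sup>2" .
  show ?thesis unfolding eq using assms(1) by (simp add: field_simps power2_eq_square)
qed

definition log_pot :: "real \<Rightarrow> nat \<Rightarrow> real \<Rightarrow> real" where
  "log_pot \<alpha> n \<tau> = ln (inv_mean (lmom \<alpha> (scaled_time \<alpha> n (exp \<tau>))) n)"

text \<open>The derivative of \<open>log_pot\<close>: since \<open>C\<^sub>n = R / t\<close>, it is the logarithmic derivative of \<open>R\<close> minus
  one.\<close>

definition log_pot' :: "real \<Rightarrow> nat \<Rightarrow> real \<Rightarrow> real" where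
  "log_pot' \<alpha> n \<tau> = (let N = 2 * real n + 1 + \<alpha>; t = scaled_time \<alpha> n (exp \<tau>);
      R = t * inv_mean (lmom \<alpha> t) n; r = inv_cross (lmom \<alpha> t) t n
    in (2 * r - t + N * R + R\<^sup>2) / R - 1)"

lemma painleve_family_log_pot:
  assumes \<alpha>: "0 < \<alpha>"
  shows "painleve_family \<alpha> (log_pot \<alpha>) (log_pot' \<alpha>) (\<lambda>n. 2 * real n + 1 + \<alpha>)"
proof
  show "0 < \<alpha>" by (rule \<alpha>)
next
  fix n :: nat show "2 * real n + 1 + \<alpha> = 2 * real n + 1 + \<alpha>" ..
next
  fix n :: nat and \<tau> :: real assume n: "0 < n"
  define N where "N = 2 * real n + 1 + \<alpha>"
  have N: "0 < N" using \<alpha> by (simp add: N_def add_pos_pos)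
  define T where "T x = exp x / N" for x :: real
  have T: "scaled_time \<alpha> n (exp x) = T x" for x by (simp add: scaled_time_def T_def N_def)
  have Tpos: "0 < T x" for x using N by (simp add: T_def)
  have dT: "(T has_real_derivative T x) (at x)" for x
    unfolding T_def using N by (auto intro!: derivative_eq_intros)
  define R where "R x = T x * inv_mean (lmom \<alpha> (T x)) n" for x
  define r where "r x = inv_cross (lmom \<alpha> (T x)) (T x) n" for x
  define D where "D x = 2 * r x - T x + N * R x + (R x)\<^sup>2" for x
  define E where "E x = r x + 2 * ((r x)\<^sup>2 - T x * r x) / R x - real n * T x + (2 * real n + \<alpha>) * r x" for x
  have Cpos: "0 < inv_mean (lmom \<alpha> (T x)) n" for x
    by (rule laguerre_moments.cpot_pos[OF laguerre_moments_lmom[OF \<alpha> Tpos]])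
  have Rpos: "0 < R x" for x using Cpos Tpos by (simp add: R_def)
  have dR: "(R has_real_derivative D x) (at x)" for x
    using DERIV_chain2[OF inv_mean_derivative(1)[OF \<alpha> Tpos n] dT, of x] Tpos[of x]
    by (simp add: R_def[abs_def] D_def r_def N_def)
  have dr: "(r has_real_derivative E x) (at x)" for x
    using DERIV_chain2[OF inv_mean_derivative(2)[OF \<alpha> Tpos n] dT, of x] Tpos[of x]
    by (simp add: R_def r_def[abs_def] E_def)
  have lp: "log_pot \<alpha> n = (\<lambda>x. ln (R x) - x + ln N)"
  proof
    fix x
    have "inv_mean (lmom \<alpha> (T x)) n = R x / exp x * N" using N by (simp add: R_def T_def)
    then show "log_pot \<alpha> n x = ln (R x) - x + ln N"
      unfolding log_pot_def T using Rpos[of x] N by (simp add: ln_mult ln_div)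
  qed
  have lp': "log_pot' \<alpha> n = (\<lambda>x. D x / R x - 1)"
    unfolding log_pot'_def T Let_def by (simp add: D_def r_def R_def N_def)
  show "(log_pot \<alpha> n has_real_derivative log_pot' \<alpha> n \<tau>) (at \<tau>)"
    unfolding lp lp' using Rpos[of \<tau>] by (auto intro!: derivative_eq_intros dR)
  have "((\<lambda>x. (2 * r x - T x + N * R x + (R x)\<^sup>2) / R x - 1) has_real_derivative
      ((2 * E \<tau> - T \<tau> + N * D \<tau> + 2 * R \<tau> * D \<tau>) * R \<tau> - (2 * r \<tau> - T \<tau> + N * R \<tau> + (R \<tau>)\<^sup>2) * D \<tau>)
        / (R \<tau> * R \<tau>)) (at \<tau>)"
    using Rpos[of \<tau>] by (auto intro!: derivative_eq_intros dR dr dT)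
  also have "((2 * E \<tau> - T \<tau> + N * D \<tau> + 2 * R \<tau> * D \<tau>) * R \<tau> - (2 * r \<tau> - T \<tau> + N * R \<tau> + (R \<tau>)\<^sup>2) * D \<tau>)
        / (R \<tau> * R \<tau>) = N * R \<tau> + (R \<tau>)\<^sup>2 + \<alpha> * (T \<tau> / R \<tau>) - (T \<tau> / R \<tau>)\<^sup>2"
    unfolding D_def E_def by (rule painleve_rhs_identity) (use Rpos[of \<tau>] in \<open>auto simp: N_def\<close>)
  also have "\<dots> = painleve_rhs \<alpha> (1 / N\<^sup>2) \<tau> (log_pot \<alpha> n \<tau>)"
  proof -
    define L where "L = log_pot \<alpha> n \<tau>"
    have eL: "exp L = inv_mean (lmom \<alpha> (T \<tau>)) n" unfolding L_def log_pot_def T using Cpos by simp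
    have 1: "exp (\<tau> + L) = N * R \<tau>" using N by (simp add: exp_add eL R_def T_def)
    have 2: "exp (- L) = T \<tau> / R \<tau>" using Tpos[of \<tau>] by (simp add: exp_minus eL R_def field_simps)
    have 3: "exp (2 * \<tau> + 2 * L) = (N * R \<tau>)\<^sup>2" "exp (- 2 * L) = (T \<tau> / R \<tau>)\<^sup>2"
      unfolding 1[symmetric] 2[symmetric] by (simp_all add: power2_eq_square flip: exp_add)
    show ?thesis unfolding L_def[symmetric] painleve_rhs_def 1 2 3 using N by (simp add: power_mult_distrib)
  qed
  finally show "(log_pot' \<alpha> n has_real_derivative painleve_rhs \<alpha> (1 / (2 * real n + 1 + \<alpha>)\<^sup>2) \<tau> (log_pot \<alpha> n \<tau>)) (at \<tau>)"
    unfolding lp' D_def N_def .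
  have Cle: "inv_mean (lmom \<alpha> (T \<tau>)) n \<le> 1 / \<alpha>"
    by (rule laguerre_moments.cpot_le[OF laguerre_moments_lmom[OF \<alpha> Tpos]])
  then have "ln (inv_mean (lmom \<alpha> (T \<tau>)) n) \<le> ln (1 / \<alpha>)" using Cpos \<alpha> by simp
  then show "log_pot \<alpha> n \<tau> \<le> - ln \<alpha>" unfolding log_pot_def T using \<alpha> by (simp add: ln_div)
  assume "\<tau> \<le> ln (2 * real n + 1 + \<alpha>)"
  then have "exp \<tau> \<le> exp (ln N)" by (simp add: N_def)
  then have T1: "T \<tau> \<le> 1" using N by (simp add: T_def)
  have "1 / (N + T \<tau> / \<alpha>) \<le> inv_mean (lmom \<alpha> (T \<tau>)) n"
    unfolding N_def by (rule laguerre_moments.cpot_ge[OF laguerre_moments_lmom[OF \<alpha> Tpos]])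
  moreover have "1 / (N + 1 / \<alpha>) \<le> 1 / (N + T \<tau> / \<alpha>)"
    using T1 N \<alpha> Tpos[of \<tau>] by (intro frac_le add_mono divide_right_mono) (auto intro!: add_pos_pos)
  ultimately have "1 / (N + 1 / \<alpha>) \<le> inv_mean (lmom \<alpha> (T \<tau>)) n" by simp
  moreover have "0 < N + 1 / \<alpha>" using N \<alpha> by (simp add: add_pos_pos)
  ultimately have "ln (1 / (N + 1 / \<alpha>)) \<le> ln (inv_mean (lmom \<alpha> (T \<tau>)) n)"
    using Cpos[of \<tau>] by (subst ln_le_cancel_iff) auto
  then show "- ln (2 * real n + 1 + \<alpha> + 1 / \<alpha>) \<le> log_pot \<alpha> n \<tau>"
    unfolding log_pot_def T N_def[symmetric] using \<open>0 < N + 1 / \<alpha>\<close> by (simp add: ln_div)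
qed

text \<open>The left-hand side is \<open>t d/dt ln D\<^sub>n\<close> in the form provided by \<open>sum_cpot\<close> and \<open>brec_eq\<close>, and
  \<open>p\<close> is \<open>u\<^sub>n'\<close>. The divergent powers of \<open>n\<close> cancel on completing the square.\<close>

lemma hamiltonian_identity:
  fixes R r t c b N \<alpha> :: real
  assumes "R \<noteq> 0" and N: "N = 2 * c + 1 + \<alpha>"
    and b: "b * R = c * t - (2 * c + \<alpha>) * r - (r\<^sup>2 - t * r) / R"
  defines "p \<equiv> (2 * r - t + N * R + R\<^sup>2) / R - 1"
  shows "c * (c + \<alpha>) + r - b = r + (p - R)\<^sup>2 / 4 - (t / R - \<alpha>)\<^sup>2 / 4"
proof -
  define k where "k = r / R"
  define d where "d = t / R"
  have r: "r = k * R" and t: "t = d * R" using assms(1) by (auto simp: k_def d_def)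
  have "(r\<^sup>2 - t * r) / R = (k\<^sup>2 - d * k) * R"
    unfolding r t using assms(1) by (simp add: power2_eq_square field_simps)
  then have "b * R = (c * d - (2 * c + \<alpha>) * k - (k\<^sup>2 - d * k)) * R"
    using b unfolding r t by (simp add: algebra_simps)
  then have b': "b = c * d - (2 * c + \<alpha>) * k - (k\<^sup>2 - d * k)" using assms(1) by simp
  have p: "p - R = 2 * k - d + N - 1"
    using assms(1) unfolding p_def r t by (simp add: field_simps power2_eq_square)
  show ?thesis unfolding p d_def[symmetric] b' N by (simp add: power2_eq_square field_simps)
qed

text \<open>The derivative of \<open>ln D\<^sub>n\<close> in the scaled time. Its value at \<open>0\<close> is irrelevant to integrals and
  is set to zero because the integrand of the theorem, a quotient by \<open>\<xi>\<close>, takes that value there: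
  the convergence then holds at every point.\<close>

definition log_deriv :: "real \<Rightarrow> nat \<Rightarrow> real \<Rightarrow> real" where
  "log_deriv \<alpha> n x = (if x \<le> 0 then 0
     else - (\<Sum>j<n. inv_mean (lmom \<alpha> (scaled_time \<alpha> n x)) j) / (2 * real n + 1 + \<alpha>))"

lemma log_deriv_bound:
  assumes \<alpha>: "0 < \<alpha>"
  shows "\<bar>log_deriv \<alpha> n x\<bar> \<le> 1 / (2 * \<alpha>)"
proof (cases "x \<le> 0")
  case False
  define N where "N = 2 * real n + 1 + \<alpha>"
  have N: "0 < N" using \<alpha> by (simp add: N_def add_pos_pos)
  have t: "0 < scaled_time \<alpha> n x" using False N by (simp add: scaled_time_def N_def)
  interpret laguerre_moments "lmom \<alpha> (scaled_time \<alpha> n x)" \<alpha> "scaled_time \<alpha> n x"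
    by (rule laguerre_moments_lmom[OF \<alpha> t])
  have "0 \<le> (\<Sum>j<n. cpot j)" using cpot_pos by (intro sum_nonneg) (simp add: less_imp_le)
  moreover have "(\<Sum>j<n. cpot j) \<le> real n * (1 / \<alpha>)"
    using sum_bounded_above[of "{..<n}" cpot "1 / \<alpha>"] cpot_le by simp
  moreover have "log_deriv \<alpha> n x = - ((\<Sum>j<n. cpot j) / N)"
    using False by (simp add: log_deriv_def N_def)
  ultimately have "\<bar>log_deriv \<alpha> n x\<bar> \<le> real n * (1 / \<alpha>) / N"
    using N divide_right_mono[of "\<Sum>j<n. cpot j" "real n * (1 / \<alpha>)" N] by simp
  also have "\<dots> \<le> 1 / (2 * \<alpha>)"
  proof -
    have "real n / N \<le> 1 / 2"
      using N \<alpha> by (subst pos_divide_le_eq) (auto simp: N_def)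
    then have "real n / N * (1 / \<alpha>) \<le> 1 / 2 * (1 / \<alpha>)" using \<alpha> by (intro mult_right_mono) auto
    then show ?thesis by (simp add: mult.commute)
  qed
  finally show ?thesis .
qed (use \<alpha> in \<open>simp add: log_deriv_def\<close>)

lemma Delta_seq_pos:
  assumes "0 < \<alpha>" "0 \<le> s"
  shows "0 < Delta_seq s \<alpha> n"
proof -
  have "0 < hankel_det n t \<alpha>" if "0 \<le> t" for t
    using that assms positive_moments.hnorm_pos[OF positive_moments_lmom]
    by (simp add: hankel_det_eq_prod prod_pos)
  then show ?thesis using assms by (simp add: Delta_seq_def scaled_time_def)
qed

lemma ln_Delta_seq_has_integral:
  assumes \<alpha>: "0 < \<alpha>" and s: "0 \<le> s"
  shows "(log_deriv \<alpha> n has_integral ln (Delta_seq s \<alpha> n)) {0..s}"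
proof -
  define N where "N = 2 * real n + 1 + \<alpha>"
  have N: "0 < N" using \<alpha> by (simp add: N_def add_pos_pos)
  have T: "scaled_time \<alpha> n x = x / N" for x by (simp add: scaled_time_def N_def)
  define f where "f x = (\<Sum>j<n. ln (hnorm (lmom \<alpha> (x / N)) j))" for x
  have hpos: "0 < hnorm (lmom \<alpha> (x / N)) j" if "0 \<le> x" for x j
    using that N by (intro positive_moments.hnorm_pos positive_moments_lmom \<alpha>) simp
  have lnD: "ln (hankel_det n (x / N) \<alpha>) = f x" if "0 \<le> x" for x
    using that N hpos[OF that] by (simp add: hankel_det_eq_prod \<alpha> f_def ln_prod less_imp_neq[symmetric])
  have "(log_deriv \<alpha> n has_integral f s - f 0) {0..s}"
  proof (rule fundamental_theorem_of_calculus_interior[OF s])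
    have c: "continuous_on {0..s} (\<lambda>x. hnorm (lmom \<alpha> (x / N)) j)" for j
      using N by (intro continuous_on_compose2[OF hnorm_lmom_continuous_on[OF \<alpha>]] continuous_intros) auto
    show "continuous_on {0..s} f"
      unfolding f_def using hpos by (intro continuous_intros c) (force simp: less_imp_neq[symmetric])
    fix x assume "x \<in> {0<..<s}"
    then have x: "0 < x" by simp
    have "((\<lambda>x. hnorm (lmom \<alpha> (x / N)) j) has_real_derivative
       - inv_mean (lmom \<alpha> (x / N)) j * hnorm (lmom \<alpha> (x / N)) j * (1 / N)) (at x)" for j
      by (rule DERIV_chain2[OF hnorm_derivative]) (use \<alpha> x N in \<open>auto intro!: derivative_eq_intros\<close>)
    then have "((\<lambda>x. ln (hnorm (lmom \<alpha> (x / N)) j)) has_real_derivative - inv_mean (lmom \<alpha> (x / N)) j / N) (at x)" for j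
      using hpos[of x j] x by (auto intro!: derivative_eq_intros)
    then have "(f has_real_derivative (\<Sum>j<n. - inv_mean (lmom \<alpha> (x / N)) j / N)) (at x)"
      unfolding f_def by (intro DERIV_sum) auto
    also have "(\<Sum>j<n. - inv_mean (lmom \<alpha> (x / N)) j / N) = log_deriv \<alpha> n x"
      using x by (simp add: log_deriv_def T N_def[symmetric] sum_negf sum_divide_distrib)
    finally show "(f has_vector_derivative log_deriv \<alpha> n x) (at x)"
      by (simp add: has_real_derivative_iff_has_vector_derivative)
  qed
  moreover have "ln (Delta_seq s \<alpha> n) = f s - f 0"
  proof -
    have "0 < hankel_det n (x / N) \<alpha>" if "0 \<le> x" for x
      using that N hpos[OF that] by (simp add: hankel_det_eq_prod \<alpha> prod_pos)
    from this[of s] this[of 0] show ?thesis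
      using lnD[of s] lnD[of 0] s by (simp add: Delta_seq_def T ln_div)
  qed
  ultimately show ?thesis by simp
qed

lemma log_deriv_eq:
  assumes \<alpha>: "0 < \<alpha>" and x: "0 < x" and n: "0 < n"
  defines "t \<equiv> scaled_time \<alpha> n x" and "C \<equiv> C_seq \<alpha> x n" and "p \<equiv> log_pot' \<alpha> n (ln x)"
  shows "x * log_deriv \<alpha> n x = (t * C * (p + 1) + t - x * C - (t * C)\<^sup>2) / 2
     + (p - t * C)\<^sup>2 / 4 - (1 / C - \<alpha>)\<^sup>2 / 4"
proof -
  define N where "N = 2 * real n + 1 + \<alpha>"
  have N: "0 < N" using \<alpha> by (simp add: N_def add_pos_pos)
  have t_eq: "t = x / N" by (simp add: t_def scaled_time_def N_def)
  have t: "0 < t" using x N by (simp add: t_eq)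
  interpret laguerre_moments "lmom \<alpha> t" \<alpha> t by (rule laguerre_moments_lmom[OF \<alpha> t])
  have C: "C = cpot n" unfolding C_def t_def by (rule C_seq_eq_inv_mean[OF \<alpha> x])
  define R where "R = t * C"
  define r where "r = rvar n"
  define b where "b = brec (lmom \<alpha> t) n"
  have R: "0 < R" using t cpot_pos[of n] by (simp add: R_def C)
  have p: "p = (2 * r - t + N * R + R\<^sup>2) / R - 1"
    unfolding p_def log_pot'_def Let_def using x
    by (simp add: t_def[symmetric] N_def[symmetric] R_def C r_def)
  have bR: "b * R = real n * t - (2 * real n + \<alpha>) * r - (r\<^sup>2 - t * r) / R"
  proof -
    have "(r\<^sup>2 - t * r) / R = b * (t * cpot (n - 1))"
    proof -
      have "r\<^sup>2 - t * r = b * (t * cpot (n - 1)) * R"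
        using rvar_quadratic(1)[OF n] by (simp add: r_def b_def R_def C mult_ac)
      then show ?thesis using R by simp
    qed
    then show ?thesis
      using rvar_quadratic(2)[OF n] by (simp add: r_def b_def R_def C algebra_simps)
  qed
  have "x * log_deriv \<alpha> n x = - t * (\<Sum>j<n. cpot j)"
    using x by (simp add: log_deriv_def t_def[symmetric] N_def[symmetric] t_eq)
  also have "\<dots> = real n * (real n + \<alpha>) + r - b"
    unfolding sum_cpot[OF n] b_def brec_eq[OF n] r_def by simp
  also have "\<dots> = r + (p - R)\<^sup>2 / 4 - (t / R - \<alpha>)\<^sup>2 / 4"
    unfolding p by (rule hamiltonian_identity[OF _ _ bR]) (use R in \<open>auto simp: N_def\<close>)
  also have "r = (R * (p + 1) + t - x * C - R\<^sup>2) / 2"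
  proof -
    have "R * (p + 1) = 2 * r - t + N * R + R\<^sup>2" using R by (simp add: p)
    moreover have "N * R = x * C" using N by (simp add: R_def t_eq)
    ultimately show ?thesis by simp
  qed
  also have "t / R = 1 / C" using t by (simp add: R_def)
  finally show ?thesis unfolding R_def .
qed

theorem mainTheorem2:
  fixes \<alpha> s :: real
  assumes "\<alpha> > 0" and "s \<ge> 0"
  defines "C \<equiv> C_pot \<alpha>"
  defines "F \<equiv> (\<lambda>\<xi>. (1 / 4 * (\<xi> / C \<xi> * deriv C \<xi>)\<^sup>2 - \<xi> * C \<xi> / 2
                      - 1 / 4 * (1 / C \<xi> - \<alpha>)\<^sup>2) / \<xi>)"
  shows "convergent (Delta_seq s \<alpha>) \<and> Delta s \<alpha> > 0 \<and>
         (\<forall>\<xi>>0. convergent (C_seq \<alpha> \<xi>) \<and> C \<xi> \<noteq> 0 \<and> C differentiable (at \<xi>)) \<and>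
         F absolutely_integrable_on {0..s} \<and>
         ln (Delta s \<alpha>) = integral {0..s} F"
proof -
  note \<alpha> = \<open>\<alpha> > 0\<close>
  interpret painleve_family \<alpha> "log_pot \<alpha>" "log_pot' \<alpha>" "\<lambda>n. 2 * real n + 1 + \<alpha>"
    by (rule painleve_family_log_pot[OF \<alpha>])
  obtain v q where vq: "\<And>\<tau>. (\<lambda>n. log_pot \<alpha> n \<tau>) \<longlonglongrightarrow> v \<tau>" "\<And>\<tau>. (\<lambda>n. log_pot' \<alpha> n \<tau>) \<longlonglongrightarrow> q \<tau>"
    "\<And>\<tau>. (v has_real_derivative q \<tau>) (at \<tau>)"
    using convergence by blast
  have C_seq: "C_seq \<alpha> \<xi> n = exp (log_pot \<alpha> n (ln \<xi>))" if "0 < \<xi>" for \<xi> n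
  proof -
    have t: "0 < scaled_time \<alpha> n \<xi>" using \<alpha> that by (simp add: scaled_time_def add_pos_pos)
    then show ?thesis
      using laguerre_moments.cpot_pos[OF laguerre_moments_lmom[OF \<alpha> t], of n] that
      by (simp add: log_pot_def C_seq_eq_inv_mean \<alpha>)
  qed
  have C_lim: "C_seq \<alpha> \<xi> \<longlonglongrightarrow> exp (v (ln \<xi>))" if "0 < \<xi>" for \<xi>
    unfolding C_seq[OF that] by (intro tendsto_intros vq)
  have C_eq: "C \<xi> = exp (v (ln \<xi>))" if "0 < \<xi>" for \<xi>
    unfolding C_def C_pot_def using C_lim[OF that] by (rule limI)
  have C_deriv: "(C has_real_derivative C \<xi> * q (ln \<xi>) / \<xi>) (at \<xi>)" if \<xi>: "0 < \<xi>" for \<xi>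
  proof -
    have "((\<lambda>\<xi>. exp (v (ln \<xi>))) has_real_derivative C \<xi> * q (ln \<xi>) / \<xi>) (at \<xi>)"
      using \<xi> C_eq[OF \<xi>] by (auto intro!: derivative_eq_intros DERIV_chain2[OF vq(3)])
    moreover have "\<forall>\<^sub>F x in nhds \<xi>. C x = exp (v (ln x))"
      using eventually_nhds_in_open[of "{0<..}" \<xi>] \<xi> by (auto elim!: eventually_mono simp: C_eq)
    ultimately show ?thesis by (subst DERIV_cong_ev[OF refl _ refl])
  qed
  have part1: "\<forall>\<xi>>0. convergent (C_seq \<alpha> \<xi>) \<and> C \<xi> \<noteq> 0 \<and> C differentiable (at \<xi>)"
    using C_lim C_eq C_deriv unfolding convergent_def real_differentiable_def by (metis exp_not_eq_zero)
  have F_lim: "(\<lambda>n. log_deriv \<alpha> n \<xi>) \<longlonglongrightarrow> F \<xi>" if \<xi>: "0 \<le> \<xi>" for \<xi>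
  proof (cases "\<xi> = 0")
    case True
    then show ?thesis by (simp add: log_deriv_def F_def)
  next
    case False
    then have \<xi>: "0 < \<xi>" using that by simp
    have t: "(\<lambda>n. scaled_time \<alpha> n \<xi>) \<longlonglongrightarrow> 0"
      unfolding scaled_time_def by real_asymp
    have Cl: "C_seq \<alpha> \<xi> \<longlonglongrightarrow> C \<xi>" "C \<xi> \<noteq> 0" using C_lim[OF \<xi>] C_eq[OF \<xi>] by auto
    have "(\<lambda>n. ((scaled_time \<alpha> n \<xi> * C_seq \<alpha> \<xi> n * (log_pot' \<alpha> n (ln \<xi>) + 1) + scaled_time \<alpha> n \<xi> - \<xi> * C_seq \<alpha> \<xi> n
          - (scaled_time \<alpha> n \<xi> * C_seq \<alpha> \<xi> n)\<^sup>2) / 2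
        + (log_pot' \<alpha> n (ln \<xi>) - scaled_time \<alpha> n \<xi> * C_seq \<alpha> \<xi> n)\<^sup>2 / 4 - (1 / C_seq \<alpha> \<xi> n - \<alpha>)\<^sup>2 / 4) / \<xi>)
      \<longlonglongrightarrow> ((0 * C \<xi> * (q (ln \<xi>) + 1) + 0 - \<xi> * C \<xi> - (0 * C \<xi>)\<^sup>2) / 2
        + (q (ln \<xi>) - 0 * C \<xi>)\<^sup>2 / 4 - (1 / C \<xi> - \<alpha>)\<^sup>2 / 4) / \<xi>"
      using \<xi> by (intro tendsto_intros t Cl vq) auto
    moreover have "((0 * C \<xi> * (q (ln \<xi>) + 1) + 0 - \<xi> * C \<xi> - (0 * C \<xi>)\<^sup>2) / 2
        + (q (ln \<xi>) - 0 * C \<xi>)\<^sup>2 / 4 - (1 / C \<xi> - \<alpha>)\<^sup>2 / 4) / \<xi> = F \<xi>"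
    proof -
      have "\<xi> / C \<xi> * deriv C \<xi> = q (ln \<xi>)"
        using DERIV_imp_deriv[OF C_deriv[OF \<xi>]] Cl(2) \<xi> by simp
      then show ?thesis unfolding F_def by simp
    qed
    moreover have "\<forall>\<^sub>F n in sequentially. log_deriv \<alpha> n \<xi>
      = ((scaled_time \<alpha> n \<xi> * C_seq \<alpha> \<xi> n * (log_pot' \<alpha> n (ln \<xi>) + 1) + scaled_time \<alpha> n \<xi> - \<xi> * C_seq \<alpha> \<xi> n
          - (scaled_time \<alpha> n \<xi> * C_seq \<alpha> \<xi> n)\<^sup>2) / 2
        + (log_pot' \<alpha> n (ln \<xi>) - scaled_time \<alpha> n \<xi> * C_seq \<alpha> \<xi> n)\<^sup>2 / 4 - (1 / C_seq \<alpha> \<xi> n - \<alpha>)\<^sup>2 / 4) / \<xi>"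
      using eventually_gt_at_top[of 0]
    proof eventually_elim
      case (elim n)
      show ?case unfolding log_deriv_eq[OF \<alpha> \<xi> elim, symmetric] using \<xi> by simp
    qed
    ultimately show ?thesis by (simp add: tendsto_cong)
  qed
  have bound_int: "(\<lambda>x. 1 / (2 * \<alpha>)) integrable_on {0..s}"
    by (rule integrable_const_ivl)
  have ld_int: "log_deriv \<alpha> n integrable_on {0..s}" for n
    using ln_Delta_seq_has_integral[OF assms(1,2)] by (rule has_integral_integrable)
  note dom = dominated_convergence[where f = "log_deriv \<alpha>" and S = "{0..s}" and g = F
      and h = "\<lambda>x. 1 / (2 * \<alpha>)", OF ld_int bound_int]
  have F_int: "F integrable_on {0..s}" and
    int_lim: "(\<lambda>n. integral {0..s} (log_deriv \<alpha> n)) \<longlonglongrightarrow> integral {0..s} F"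
    by (rule dom; use F_lim log_deriv_bound[OF \<alpha>] in simp)+
  have "F absolutely_integrable_on {0..s}"
  proof (rule absolutely_integrable_integrable_bound[OF _ F_int bound_int])
    fix x assume "x \<in> {0..s}"
    then have "(\<lambda>n. \<bar>log_deriv \<alpha> n x\<bar>) \<longlonglongrightarrow> \<bar>F x\<bar>" by (intro tendsto_intros F_lim) auto
    then have "\<bar>F x\<bar> \<le> 1 / (2 * \<alpha>)"
      by (rule tendsto_upperbound) (auto intro!: always_eventually log_deriv_bound \<alpha>)
    then show "norm (F x) \<le> 1 / (2 * \<alpha>)" by simp
  qed
  moreover have "Delta_seq s \<alpha> \<longlonglongrightarrow> exp (integral {0..s} F)"
  proof -
    have "integral {0..s} (log_deriv \<alpha> n) = ln (Delta_seq s \<alpha> n)" for n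
      using ln_Delta_seq_has_integral[OF assms(1,2)] by (rule integral_unique)
    then have "(\<lambda>n. exp (ln (Delta_seq s \<alpha> n))) \<longlonglongrightarrow> exp (integral {0..s} F)"
      using int_lim by (intro tendsto_intros) simp
    then show ?thesis using Delta_seq_pos[OF assms(1,2)] by simp
  qed
  moreover from this have "Delta s \<alpha> = exp (integral {0..s} F)"
    unfolding Delta_def by (rule limI)
  ultimately show ?thesis using part1 unfolding convergent_def by (auto simp: C_def)
qed

end
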